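(* Let $v^\pm\in C^1(I;\mathbb{R}^3)$ be such that $v^\pm(t)\in V^\pm_t$ and $v^\pm(t)\neq0$ for every $t\in I$, and write $$\pi_{v^\pm(t)}=\mathrm{span}\{e_2,v^\pm(t)\}=\{(x,y,z)\in\mathbb{R}^3:\ \alpha^\pm(t)x+\beta^\pm(t)z=0\},$$ where $\alpha^\pm,\beta^\pm\in C(\bar I)$ and, for some $r>0$, $\|(\alpha^+(t),\beta^+(t))\|>r$ and $\|(\alpha^-(t),\beta^-(t))\|>r$ for all $t\in I$. Let $M\in\mathcal{P}^{\mathcal B}(I;\mathbb{R}^{2\times2}_{sym})$ be such that $A_M\in\mathcal{P}\bigl(I;\tilde{\mathcal U}_c\cap\tilde{\mathcal U}^{(\alpha^+,\beta^+)}_c\cap\tilde{\mathcal U}^{(\alpha^-,\beta^-)}_c\bigr)$ for some constant $c>0$. Then there exist functions $\lambda_n\in L^\infty(I)$ and $p_n\in L^\infty(I;\mathbb{S}^1)$ with $\lambda_n=0$ on $I\setminus I_n$ such that, setting $M^n=\lambda_n\,p_n\otimes p_n$, we have: (1) $M^n\rightharpoonup M$ weakly$^*$ in $L^\infty(I;\mathbb{R}^{2\times2}_{sym})$ and $\mathcal{F}(M^n)\to\mathcal{F}(M)$; (2) there exists a constant $\tilde c>0$, independent of $n$, such that $|M^{\mathcal B,n}_{11}(x)|\ge\tilde c$ for a.e. $x\in I_n$ and for all $n$, where $M^{\mathcal B,n}_{11}=(M^n)^{\mathcal B}_{11}$.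
   Context: $I=(0,1)$, $I_n=(1/n,1-1/n)$. $\chi:\mathbb{R}^2\to\mathbb{R}^2$ is an injective, orientation preserving ($\det\nabla\chi>0$) $C^2$ map with $|\partial_1\chi(x_1,0)|=1$ for all $x_1$, $\chi(0,0)=(0,0)$, $\partial_1\chi(0,0)=e_1$. Put $B(t)=\chi(t,0)$, $D(t)=\nabla\chi(t,0)$, $N=e_3\wedge B'$ (vectors of $\mathbb{R}^2$ are identified with vectors of $\mathbb{R}^2\times\{0\}$), $k=B''\cdot N$. $\mathcal{B}=\{B',N\}$ is a moving orthonormal basis of $\mathbb{R}^2$; also $\mathcal{B}(t)=(B'(t)|N(t))\in\mathbb{R}^{2\times2}$. $\mathbb{S}^1$ is the unit circle in $\mathbb{R}^2$. For a symmetric-matrix-valued $M$ on $I$, $M^{\mathcal B}=(M^{\mathcal B}_{ij})$ is defined by $M=M^{\mathcal B}_{11}B'\otimes B'+M^{\mathcal B}_{12}(B'\otimes N+N\otimes B')+M^{\mathcal B}_{22}N\otimes N$, and $A_M$ is the skew-symmetric $3\times3$ matrix field with $(A_M)_{12}=k$, $(A_M)_{13}=M^{\mathcal B}_{11}$, $(A_M)_{23}=M^{\mathcal B}_{12}$. $\tilde{\mathcal U}$ is the space of skew-symmetric $3\times3$ matrices. For $c>0$, $(\alpha,\beta)\in\mathbb{R}^2\setminus\{0\}$: $\tilde{\mathcal U}_c=\{A\in\tilde{\mathcal U}:|A_{13}|\ge c,\ |A_{23}|\ge c\}$, $\tilde{\mathcal U}^{(\alpha,\beta)}_c=\{A\in\tilde{\mathcal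 U}:|\alpha A_{13}+2\beta A_{23}|\ge c\}$. $M\in\mathcal{P}^{\mathcal B}(I;\mathbb{R}^{2\times2}_{sym})$ means $M\in L^\infty$ and $M^{\mathcal B}$ is piecewise constant on $I$. $A\in\mathcal{P}(I;\tilde{\mathcal U}_c\cap\tilde{\mathcal U}_c^{(\alpha^+,\beta^+)}\cap\tilde{\mathcal U}_c^{(\alpha^-,\beta^-)})$ means that $A_{13},A_{23}$ are piecewise constant (while $A_{12}=k$ need not be) and $A(x)\in\tilde{\mathcal U}_c\cap\tilde{\mathcal U}^{(\alpha^+(x),\beta^+(x))}_c\cap\tilde{\mathcal U}^{(\alpha^-(x),\beta^-(x))}_c$ for all $x\in I$. $Q$ is a positive definite quadratic form on $\mathbb{R}^{2\times2}_{sym}$, $\alpha^\pm_Q=\sup\{\alpha>0:Q(M)\pm\alpha\det M\ge0\ \forall M\in\mathbb{R}^{2\times2}_{sym}\}$ (constants, written with subscript $Q$ to distinguish them from the functions $\alpha^\pm(t)$), $a^+=\max(a,0)$, $a^-=\max(-a,0)$, and $\mathcal{F}(M)=\int_I\bigl(Q(M)+\alpha_Q^+(\det M)^++\alpha_Q^-(\det M)^-\bigr)\det D(x)\,dx$. Identify $C\in\mathbb{R}^{2\times2}_{sym}$ with $(C_{11},C_{22},2C_{12})\in\mathbb{R}^3$. Let $\mathcal{L}_t(C)=\mathcal{B}(t)^{-T}C\,\mathcal{B}(t)^{-1}$, $Q_t(C)=Q(\mathcal{L}_t(C))$, let $\mathbb{K}_t$ be the symmetric $3\times3$ matrix of $Q_t$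 in these coordinates, and let $\mathbb{D}=\begin{pmatrix}0&1/2&0\\1/2&0&0\\0&0&-1/4\end{pmatrix}$ be the matrix of the determinant. Then $V^+_t=\ker(\mathbb{K}_t+\alpha_Q^+\mathbb{D})$ and $V^-_t=\ker(\mathbb{K}_t-\alpha_Q^-\mathbb{D})$ (both nontrivial and not containing $e_2$). *)

theory Defs
  imports "HOL-Analysis.Analysis"
begin

section \<open>Function spaces on an interval\<close>

text \<open>
  Elements of Lebesgue spaces are represented by functions rather than equivalence classes;
  the constraint \<open>f x \<in> V\<close> is imposed on the representative at every point of \<open>S\<close>.
\<close>

definition Linfty_on :: "real set \<Rightarrow> 'a::euclidean_space set \<Rightarrow> (real \<Rightarrow> 'a) set" where
  "Linfty_on S V = {f. f \<in> borel_measurable (lebesgue_on S) \<and> (\<forall>x\<in>S. f x \<in> V) \<and>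
     (\<exists>C. AE x in lebesgue_on S. norm (f x) \<le> C)}"

text \<open>
  Weak* convergence in \<open>L\<^sup>\<infinity>(S; V)\<close>, the dual of \<open>L\<^sup>1(S; V)\<close>, for a linear subspace \<open>V\<close>.
  On \<open>real ^ 2 ^ 2\<close> the inner product is the Frobenius product.
\<close>

definition weak_star_Linfty ::
    "real set \<Rightarrow> 'a::euclidean_space set \<Rightarrow> (nat \<Rightarrow> real \<Rightarrow> 'a) \<Rightarrow> (real \<Rightarrow> 'a) \<Rightarrow> bool" where
  "weak_star_Linfty S V f g \<longleftrightarrow>
     (\<forall>\<^sub>F n in sequentially. f n \<in> Linfty_on S V) \<and> g \<in> Linfty_on S V \<and>
     (\<forall>\<phi>. integrable (lebesgue_on S) \<phi> \<and> (\<forall>x\<in>S. \<phi> x \<in> V) \<longrightarrow>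
        (\<lambda>n. integral\<^sup>L (lebesgue_on S) (\<lambda>x. f n x \<bullet> \<phi> x))
          \<longlonglongrightarrow> integral\<^sup>L (lebesgue_on S) (\<lambda>x. g x \<bullet> \<phi> x))"

text \<open>Constant on each member of a finite partition into (possibly one-point) intervals.\<close>

definition piecewise_constant_on :: "real set \<Rightarrow> (real \<Rightarrow> 'a) \<Rightarrow> bool" where
  "piecewise_constant_on S f \<longleftrightarrow>
     (\<exists>P. finite P \<and> partition_on S P \<and> (\<forall>J\<in>P. is_interval J \<and> f constant_on J))"

text \<open>Twice continuously (Frechet) differentiable on the whole space.\<close>

definition C2_map :: "('a::real_normed_vector \<Rightarrow> 'b::real_normed_vector) \<Rightarrow> bool" where
  "C2_map f \<longleftrightarrow>
     (\<exists>(f' :: 'a \<Rightarrow> 'a \<Rightarrow>\<^sub>L 'b) (f'' :: 'a \<Rightarrow> 'a \<Rightarrow>\<^sub>L ('a \<Rightarrow>\<^sub>L 'b)).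
        (\<forall>x. (f has_derivative blinfun_apply (f' x)) (at x)) \<and>
        (\<forall>x. (f' has_derivative blinfun_apply (f'' x)) (at x)) \<and>
        continuous_on UNIV f'')"

abbreviation unit_ival :: "real set" where
  "unit_ival \<equiv> {0<..<1}"

definition inner_ival :: "nat \<Rightarrow> real set" where
  "inner_ival n = {1 / real n <..< 1 - 1 / real n}"


section \<open>Matrices and quadratic forms\<close>

definition outer :: "real ^ 2 \<Rightarrow> real ^ 2 \<Rightarrow> real ^ 2 ^ 2" where
  "outer p q = (\<chi> i j. p $ i * q $ j)"

definition sym_mat :: "(real ^ 2 ^ 2) set" where
  "sym_mat = {A. transpose A = A}"

definition quadratic_form_on :: "'a::real_vector set \<Rightarrow> ('a \<Rightarrow> real) \<Rightarrow> bool" where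
  "quadratic_form_on S Q \<longleftrightarrow> (\<exists>b. bilinear b \<and> (\<forall>x\<in>S. Q x = b x x))"

definition pos_def_on :: "'a::real_vector set \<Rightarrow> ('a \<Rightarrow> real) \<Rightarrow> bool" where
  "pos_def_on S Q \<longleftrightarrow> (\<forall>x\<in>S. x \<noteq> 0 \<longrightarrow> Q x > 0)"

definition alphaQ_plus :: "(real ^ 2 ^ 2 \<Rightarrow> real) \<Rightarrow> real" where
  "alphaQ_plus Q = Sup {a. a > 0 \<and> (\<forall>M\<in>sym_mat. Q M + a * det M \<ge> 0)}"

definition alphaQ_minus :: "(real ^ 2 ^ 2 \<Rightarrow> real) \<Rightarrow> real" where
  "alphaQ_minus Q = Sup {a. a > 0 \<and> (\<forall>M\<in>sym_mat. Q M - a * det M \<ge> 0)}"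


section \<open>The moving frame along the centerline\<close>

text \<open>Here \<open>chi\<close> is the map from the plane to itself (the Greek letter is the binder for vectors).\<close>

definition centerline :: "(real ^ 2 \<Rightarrow> real ^ 2) \<Rightarrow> real \<Rightarrow> real ^ 2" where
  "centerline chi t = chi (vector [t, 0])"

definition D_mat :: "(real ^ 2 \<Rightarrow> real ^ 2) \<Rightarrow> real \<Rightarrow> real ^ 2 ^ 2" where
  "D_mat chi t = jacobian chi (at (vector [t, 0]))"

definition tangent :: "(real ^ 2 \<Rightarrow> real ^ 2) \<Rightarrow> real \<Rightarrow> real ^ 2" where
  "tangent chi t = vector_derivative (centerline chi) (at t)"

definition embed3 :: "real ^ 2 \<Rightarrow> real ^ 3" where
  "embed3 v = vector [v $ 1, v $ 2, 0]"

definition unembed3 :: "real ^ 3 \<Rightarrow> real ^ 2" where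
  "unembed3 w = vector [w $ 1, w $ 2]"

definition normal_vec :: "(real ^ 2 \<Rightarrow> real ^ 2) \<Rightarrow> real \<Rightarrow> real ^ 2" where
  "normal_vec chi t = unembed3 (cross3 (axis 3 1) (embed3 (tangent chi t)))"

definition curvature :: "(real ^ 2 \<Rightarrow> real ^ 2) \<Rightarrow> real \<Rightarrow> real" where
  "curvature chi t = vector_derivative (tangent chi) (at t) \<bullet> normal_vec chi t"

text \<open>\<open>vector\<close> lists rows, so the matrix with columns \<open>B'\<close> and \<open>N\<close> is a transpose.\<close>

definition frame_mat :: "(real ^ 2 \<Rightarrow> real ^ 2) \<Rightarrow> real \<Rightarrow> real ^ 2 ^ 2" where
  "frame_mat chi t = transpose (vector [tangent chi t, normal_vec chi t])"

text \<open>
  The coefficients of the symmetric matrix \<open>M\<close> with respect to the orthonormal frame at \<open>t\<close>;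
  they exist and are unique when \<open>tangent chi t\<close> has norm 1.
\<close>

definition frame_coeffs ::
    "(real ^ 2 \<Rightarrow> real ^ 2) \<Rightarrow> real \<Rightarrow> real ^ 2 ^ 2 \<Rightarrow> real ^ 2 ^ 2" where
  "frame_coeffs chi t M = (THE C. C \<in> sym_mat \<and>
     M = C $ 1 $ 1 *\<^sub>R outer (tangent chi t) (tangent chi t)
       + C $ 1 $ 2 *\<^sub>R (outer (tangent chi t) (normal_vec chi t)
                        + outer (normal_vec chi t) (tangent chi t))
       + C $ 2 $ 2 *\<^sub>R outer (normal_vec chi t) (normal_vec chi t))"


section \<open>Skew-symmetric fields\<close>

definition A_field ::
    "(real ^ 2 \<Rightarrow> real ^ 2) \<Rightarrow> (real \<Rightarrow> real ^ 2 ^ 2) \<Rightarrow> real \<Rightarrow> real ^ 3 ^ 3" where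
  "A_field chi M t =
     (let k = curvature chi t; C = frame_coeffs chi t (M t) in
      vector [vector [0, k, C $ 1 $ 1],
              vector [- k, 0, C $ 1 $ 2],
              vector [- (C $ 1 $ 1), - (C $ 1 $ 2), 0]])"

definition U_skew :: "(real ^ 3 ^ 3) set" where
  "U_skew = {A. transpose A = - A}"

definition U_skew_c :: "real \<Rightarrow> (real ^ 3 ^ 3) set" where
  "U_skew_c c = {A \<in> U_skew. \<bar>A $ 1 $ 3\<bar> \<ge> c \<and> \<bar>A $ 2 $ 3\<bar> \<ge> c}"

definition U_skew_ab :: "real \<Rightarrow> real \<Rightarrow> real \<Rightarrow> (real ^ 3 ^ 3) set" where
  "U_skew_ab c a b = {A \<in> U_skew. \<bar>a * A $ 1 $ 3 + 2 * b * A $ 2 $ 3\<bar> \<ge> c}"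

text \<open>Only the entries 13 and 23 are required to be piecewise constant; the entry 12 is not.\<close>

definition PC_skew :: "real set \<Rightarrow> (real \<Rightarrow> (real ^ 3 ^ 3) set) \<Rightarrow> (real \<Rightarrow> real ^ 3 ^ 3) set" where
  "PC_skew S V = {A. piecewise_constant_on S (\<lambda>x. A x $ 1 $ 3) \<and>
                     piecewise_constant_on S (\<lambda>x. A x $ 2 $ 3) \<and>
                     (\<forall>x\<in>S. A x \<in> V x)}"

definition PC_frame :: "(real ^ 2 \<Rightarrow> real ^ 2) \<Rightarrow> (real \<Rightarrow> real ^ 2 ^ 2) set" where
  "PC_frame chi = {M \<in> Linfty_on unit_ival sym_mat.
                     piecewise_constant_on unit_ival (\<lambda>t. frame_coeffs chi t (M t))}"


section \<open>The energy and the degenerate directions\<close>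

definition energy ::
    "(real ^ 2 \<Rightarrow> real ^ 2) \<Rightarrow> (real ^ 2 ^ 2 \<Rightarrow> real) \<Rightarrow> (real \<Rightarrow> real ^ 2 ^ 2) \<Rightarrow> real" where
  "energy chi Q M = integral\<^sup>L (lebesgue_on unit_ival)
     (\<lambda>x. (Q (M x) + alphaQ_plus Q * max (det (M x)) 0
                   + alphaQ_minus Q * max (- det (M x)) 0) * det (D_mat chi x))"

text \<open>Inverse of the identification \<open>C \<mapsto> (C\<^sub>1\<^sub>1, C\<^sub>2\<^sub>2, 2 C\<^sub>1\<^sub>2)\<close>.\<close>

definition sym_of_vec :: "real ^ 3 \<Rightarrow> real ^ 2 ^ 2" where
  "sym_of_vec w = vector [vector [w $ 1, w $ 3 / 2], vector [w $ 3 / 2, w $ 2]]"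

definition L_map :: "(real ^ 2 \<Rightarrow> real ^ 2) \<Rightarrow> real \<Rightarrow> real ^ 2 ^ 2 \<Rightarrow> real ^ 2 ^ 2" where
  "L_map chi t C =
     transpose (matrix_inv (frame_mat chi t)) ** C ** matrix_inv (frame_mat chi t)"

definition Q_frame ::
    "(real ^ 2 \<Rightarrow> real ^ 2) \<Rightarrow> (real ^ 2 ^ 2 \<Rightarrow> real) \<Rightarrow> real \<Rightarrow> real ^ 2 ^ 2 \<Rightarrow> real" where
  "Q_frame chi Q t C = Q (L_map chi t C)"

definition K_mat ::
    "(real ^ 2 \<Rightarrow> real ^ 2) \<Rightarrow> (real ^ 2 ^ 2 \<Rightarrow> real) \<Rightarrow> real \<Rightarrow> real ^ 3 ^ 3" where
  "K_mat chi Q t = (THE K. transpose K = K \<and>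
     (\<forall>w. Q_frame chi Q t (sym_of_vec w) = w \<bullet> (K *v w)))"

definition det_mat :: "real ^ 3 ^ 3" where
  "det_mat = vector [vector [0, 1/2, 0], vector [1/2, 0, 0], vector [0, 0, - (1/4)]]"

definition V_plus ::
    "(real ^ 2 \<Rightarrow> real ^ 2) \<Rightarrow> (real ^ 2 ^ 2 \<Rightarrow> real) \<Rightarrow> real \<Rightarrow> (real ^ 3) set" where
  "V_plus chi Q t = {w. (K_mat chi Q t + alphaQ_plus Q *\<^sub>R det_mat) *v w = 0}"

definition V_minus ::
    "(real ^ 2 \<Rightarrow> real ^ 2) \<Rightarrow> (real ^ 2 ^ 2 \<Rightarrow> real) \<Rightarrow> real \<Rightarrow> (real ^ 3) set" where
  "V_minus chi Q t = {w. (K_mat chi Q t - alphaQ_minus Q *\<^sub>R det_mat) *v w = 0}"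

end

theory Submission
  imports Defs
begin

text \<open>
  Fix \<open>t\<close>, put \<open>X = M t\<close> and suppose \<open>det X > 0\<close>; the case \<open>det X < 0\<close> is symmetric and \<open>det X = 0\<close>
  is trivial. The form \<open>Q + \<alpha>\<^sub>Q\<^sup>+ det\<close> is constant on the line \<open>X + s V\<close>, where \<open>V\<close> is the matrix with
  frame coordinates \<open>v\<^sup>+(t)\<close>. Since \<open>det V < 0 < det X\<close>, this line meets \<open>det = 0\<close> at parameters of
  opposite signs, so \<open>X\<close> is a convex combination of two rank-one matrices at which \<open>Q\<close> equals the
  energy density of \<open>X\<close>. Alternating rapidly between them with the right volume fraction converges
  weakly* to \<open>M\<close> without changing the energy density at any point of \<open>I\<^sub>n\<close>.
  If the tangential frame coefficient of one of the rank-one matrices were small, so would be its mixed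
  coefficient, and then \<open>\<alpha> x + \<beta> z\<close>, which is constant on the line, would be small as well.
\<close>

section \<open>Oscillating indicator functions\<close>

text \<open>Let \<open>S = K_mat + a det_mat\<close>. If \<open>v\<close> is in the kernel of the
  symmetric matrix \<open>S\<close>, the cross terms of the form vanish together with its value at
  \<open>v\<close>; this is the constancy on the line. Starting the line at \<open>X = 0\<close>
  gives \<open>Q V = - a det V\<close>, and positivity of \<open>Q\<close> then decides the sign of
  \<open>det V\<close>.

  The obstacle is uniformity in t. The directions \<open>vp\<close> and \<open>vm\<close> are
  controlled only on the open interval and may degenerate at its ends, which leaves both
  \<open>V\<close> and the roots on the line without a bound. The rank-one matrices are bounded
  nevertheless: \<open>Q\<close> is coercive, and its value at them is the energy density of
  \<open>M\<close>, which is essentially bounded. This bound \<open>R\<close> and a bound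
  \<open>L\<close> for the plane coefficients determine the final constant.

  The volume fraction may vary with t, since the kernels turn with the frame, so oscillation at a
  fixed ratio does not suffice: indicators with a prescribed weak* limit \<theta> are constructed.
  One sequence serves all test functions, because the two matrices do not depend on n and testing
  reduces to scalar integrals. The energy is nonlinear, so its limit is obtained separately, by
  dominated convergence.\<close>

lemma weak_null_dominated_limit:
  fixes f s :: "nat \<Rightarrow> 'a \<Rightarrow> real" and g :: "'a \<Rightarrow> real"
  assumes f [measurable]: "\<And>n. f n \<in> borel_measurable M" and f_le: "\<And>n x. \<bar>f n x\<bar> \<le> 1"
    and s [measurable]: "\<And>i. s i \<in> borel_measurable M"
    and g [measurable]: "g \<in> borel_measurable M"
    and w: "integrable M w"
    and lim: "\<And>x. x \<in> space M \<Longrightarrow> (\<lambda>i. s i x) \<longlonglongrightarrow> g x"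
    and dom: "\<And>i x. x \<in> space M \<Longrightarrow> \<bar>s i x\<bar> \<le> w x"
    and null: "\<And>i. (\<lambda>n. \<integral>x. f n x * s i x \<partial>M) \<longlonglongrightarrow> 0"
  shows "(\<lambda>n. \<integral>x. f n x * g x \<partial>M) \<longlonglongrightarrow> 0"
proof (rule LIMSEQ_I)
  fix e :: real assume e: "0 < e"
  have w0: "0 \<le> w x" if "x \<in> space M" for x
    using dom[OF that, of 0] by linarith
  have int_s: "integrable M (s i)" for i
    by (rule Bochner_Integration.integrable_bound[OF w]) (use dom w0 in \<open>auto intro!: AE_I2\<close>)
  have int_g: "integrable M g"
    by (rule integrable_dominated_convergence[where w = w and s = s]) (use w lim dom in auto)
  have int_f: "integrable M (\<lambda>x. f n x * h x)" if "integrable M h" for n h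
  proof (rule Bochner_Integration.integrable_bound[OF that])
    show "(\<lambda>x. f n x * h x) \<in> borel_measurable M"
      using borel_measurable_integrable[OF that] by measurable
    show "AE x in M. norm (f n x * h x) \<le> norm (h x)"
      using f_le by (simp add: abs_mult mult_left_le_one_le)
  qed
  \<comment> \<open>Since \<open>f n\<close> is bounded by 1, replacing \<open>g\<close> by
    \<open>s i\<close> costs at most this L1 distance, uniformly in n. Hence \<open>i\<close> can be
    fixed before \<open>N\<close>.\<close>
  have "(\<lambda>i. \<integral>x. \<bar>g x - s i x\<bar> \<partial>M) \<longlonglongrightarrow> (\<integral>x. 0 \<partial>M)"
  proof (rule integral_dominated_convergence[where w = "\<lambda>x. 2 * w x"])
    show "AE x in M. (\<lambda>i. \<bar>g x - s i x\<bar>) \<longlonglongrightarrow> 0"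
      using lim by (intro AE_I2 tendsto_rabs_zero) (auto intro!: tendsto_eq_intros)
    have "\<bar>g x\<bar> \<le> w x" if "x \<in> space M" for x
      by (rule LIMSEQ_le_const2[OF tendsto_rabs[OF lim[OF that]]]) (use dom that in auto)
    note g_le = this
    show "AE x in M. norm \<bar>g x - s i x\<bar> \<le> 2 * w x" for i
    proof (rule AE_I2)
      fix x assume "x \<in> space M"
      then have "\<bar>g x\<bar> \<le> w x" "\<bar>s i x\<bar> \<le> w x"
        using dom g_le by auto
      then show "norm \<bar>g x - s i x\<bar> \<le> 2 * w x" by (simp add: abs_le_iff)
    qed
  qed (use w in auto)
  then have "(\<lambda>i. \<integral>x. \<bar>g x - s i x\<bar> \<partial>M) \<longlonglongrightarrow> 0" by simp
  from LIMSEQ_D[OF this, of "e/2"] e obtain i where i: "\<bar>\<integral>x. \<bar>g x - s i x\<bar> \<partial>M\<bar> < e/2"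
    by auto
  from LIMSEQ_D[OF null[of i], of "e/2"] e obtain N
    where N: "\<And>n. n \<ge> N \<Longrightarrow> \<bar>\<integral>x. f n x * s i x \<partial>M\<bar> < e/2"
    by auto
  have "norm ((\<integral>x. f n x * g x \<partial>M) - 0) < e" if "n \<ge> N" for n
  proof -
    have "(\<integral>x. f n x * g x \<partial>M) - (\<integral>x. f n x * s i x \<partial>M) = (\<integral>x. f n x * (g x - s i x) \<partial>M)"
      using int_f[OF int_g] int_f[OF int_s] by (simp add: right_diff_distrib)
    moreover have "\<bar>\<integral>x. f n x * (g x - s i x) \<partial>M\<bar> \<le> (\<integral>x. \<bar>f n x * (g x - s i x)\<bar> \<partial>M)"
      by (rule integral_abs_bound)
    also have "\<dots> \<le> (\<integral>x. \<bar>g x - s i x\<bar> \<partial>M)"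
    proof (rule integral_mono)
      show "integrable M (\<lambda>x. \<bar>f n x * (g x - s i x)\<bar>)" "integrable M (\<lambda>x. \<bar>g x - s i x\<bar>)"
        using int_f[of "\<lambda>x. g x - s i x"] int_g int_s by auto
      show "\<bar>f n x * (g x - s i x)\<bar> \<le> \<bar>g x - s i x\<bar>" for x
        using f_le mult_right_mono[of "\<bar>f n x\<bar>" 1 "\<bar>g x - s i x\<bar>"] by (simp add: abs_mult)
    qed
    ultimately show ?thesis using i N[OF that] unfolding real_norm_def by linarith
  qed
  then show "\<exists>no. \<forall>n\<ge>no. norm ((\<integral>x. f n x * g x \<partial>M) - 0) < e" by blast
qed

text \<open>Half-lines are an intersection-stable generator of the Borel sets, so a Dynkin argument
  extends \<open>seg\<close> to Borel sets, with \<open>all\<close> supplying the complements.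
  Density of simple functions then reaches every integrable \<open>g\<close>. The uniform bound on
  \<open>f\<close> is what carries both limit passages.\<close>

lemma weak_null_if_initial_segments:
  fixes f :: "nat \<Rightarrow> real \<Rightarrow> real" and S :: "real set"
  assumes S: "S \<in> lmeasurable"
    and f [measurable]: "\<And>n. f n \<in> borel_measurable (lebesgue_on S)"
    and f_le: "\<And>n x. \<bar>f n x\<bar> \<le> 1"
    and seg: "\<And>t. (\<lambda>n. \<integral>x. f n x * indicator {..<t} x \<partial>lebesgue_on S) \<longlonglongrightarrow> 0"
    and all: "(\<lambda>n. \<integral>x. f n x \<partial>lebesgue_on S) \<longlonglongrightarrow> 0"
    and g: "integrable (lebesgue_on S) g"
  shows "(\<lambda>n. \<integral>x. f n x * g x \<partial>lebesgue_on S) \<longlonglongrightarrow> 0"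
proof -
  let ?N = "lebesgue_on S"
  interpret N: finite_measure ?N
    by (rule finite_measure_lebesgue_on[OF S])
  have ind [measurable]: "(indicator A :: real \<Rightarrow> real) \<in> borel_measurable ?N" if "A \<in> sets borel"
    for A
    using that by (intro measurable_restrict_space1 borel_measurable_indicator) auto
  have int_f: "integrable ?N (\<lambda>x. f n x * h x)"
    if "h \<in> borel_measurable ?N" "\<And>x. \<bar>h x\<bar> \<le> 1" for n h
  proof (rule N.integrable_const_bound[where B = 1])
    show "(\<lambda>x. f n x * h x) \<in> borel_measurable ?N"
      using that by measurable
    show "AE x in ?N. norm (f n x * h x) \<le> 1"
      by (rule AE_I2) (use f_le that in \<open>auto simp: abs_mult intro!: mult_le_one\<close>)
  qed
  have borel: "(\<lambda>n. \<integral>x. f n x * indicator A x \<partial>?N) \<longlonglongrightarrow> 0" if "A \<in> sets borel" for A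
  proof -
    have eq: "sigma_sets UNIV (range (\<lambda>a::real. {..<a})) = sets borel"
    proof -
      have "borel = sigma UNIV (range (\<lambda>a::real. {..<a}))"
        using borel_eq_lessThan[where 'a = real] unfolding eucl_lessThan .
      then have "sets borel = sets (sigma UNIV (range (\<lambda>a::real. {..<a})))"
        by (rule arg_cong)
      also have "\<dots> = sigma_sets UNIV (range (\<lambda>a::real. {..<a}))"
        by (rule sets_measure_of) simp
      finally show ?thesis ..
    qed
    have "Int_stable (range (\<lambda>a::real. {..<a}))"
      unfolding Int_stable_def
    proof safe
      fix a b :: real
      have "{..<a} \<inter> {..<b} = {..<min a b}" by auto
      then show "{..<a} \<inter> {..<b} \<in> range lessThan" by auto
    qed
    moreover have "range (\<lambda>a::real. {..<a}) \<subseteq> Pow UNIV" by simp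
    ultimately show ?thesis using that[folded eq]
    proof (induction rule: sigma_sets_induct_disjoint)
      case (basic A)
      then show ?case using seg by auto
    next
      case empty
      then show ?case by simp
    next
      case (compl A)
      have [measurable]: "A \<in> sets borel" using compl by (simp add: eq)
      have "(\<integral>x. f n x * indicator (UNIV - A) x \<partial>?N)
          = (\<integral>x. f n x \<partial>?N) - (\<integral>x. f n x * indicator A x \<partial>?N)" for n
      proof -
        have "(\<integral>x. f n x * indicator (UNIV - A) x \<partial>?N)
          = (\<integral>x. f n x * 1 - f n x * indicator A x \<partial>?N)"
          by (rule Bochner_Integration.integral_cong) (auto simp: indicator_def)
        also have "\<dots> = (\<integral>x. f n x * 1 \<partial>?N) - (\<integral>x. f n x * indicator A x \<partial>?N)"
          by (intro Bochner_Integration.integral_diff int_f)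
            (use ind[of A] in \<open>auto split: split_indicator\<close>)
        finally show ?thesis by simp
      qed
      then show ?case using tendsto_diff[OF all compl(2)] by simp
    next
      case (union A)
      have A [measurable]: "A i \<in> sets borel" for i using union by (auto simp: eq)
      \<comment> \<open>Partial sums of the disjoint indicators stay below 1, which is integrable
        because the measure is finite.\<close>
      show ?case
      proof (rule weak_null_dominated_limit[where w = "\<lambda>x. 1" and s =
        "\<lambda>k x. \<Sum>i<k. indicator (A i) x"])
        show "(\<lambda>x. \<Sum>i<k. indicator (A i) x :: real) \<in> borel_measurable ?N" for k by measurable
        show "(\<lambda>k. \<Sum>i<k. indicator (A i) x) \<longlonglongrightarrow> (indicator (\<Union>i. A i) x :: real)" for x
        proof -
          have "(\<Sum>i<k. indicator (A i) x) = (indicator (\<Union>i<k. A i) x :: real)" for k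
            using \<open>disjoint_family A\<close>
            by (intro indicator_UN_disjoint[symmetric]) (auto simp: disjoint_family_on_def)
          then show ?thesis using LIMSEQ_indicator_UN[of A x] by simp
        qed
        show "\<bar>\<Sum>i<k. indicator (A i) x\<bar> \<le> (1::real)" for k x
        proof -
          have "disjoint_family_on A {..<k}"
            using \<open>disjoint_family A\<close> by (auto simp: disjoint_family_on_def)
          then have "(\<Sum>i<k. indicator (A i) x) = (indicator (\<Union>i<k. A i) x :: real)"
            by (simp add: indicator_UN_disjoint)
          then show ?thesis by (simp add: indicator_def)
        qed
        show "(\<lambda>n. \<integral>x. f n x * (\<Sum>i<k. indicator (A i) x) \<partial>?N) \<longlonglongrightarrow> 0" for k
        proof -
          have "(\<integral>x. f n x * (\<Sum>i<k. indicator (A i) x) \<partial>?N)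
              = (\<Sum>i<k. \<integral>x. f n x * indicator (A i) x \<partial>?N)" for n
            unfolding sum_distrib_left
            by (intro Bochner_Integration.integral_sum int_f)
              (use ind[OF A] in \<open>auto split: split_indicator\<close>)
          then show ?thesis using union(3) by (auto intro!: tendsto_null_sum)
        qed
        show "(indicator (\<Union>i. A i) :: real \<Rightarrow> real) \<in> borel_measurable ?N" by (rule ind) auto
      qed (use f f_le in auto)
    qed
  qed
  show ?thesis using g
  proof (induction rule: integrable_induct)
    case (base A c)
    \<comment> \<open>A Lebesgue set is Borel up to a null set, which the integral does not
      see.\<close>
    from base(1) obtain A' where A': "A' \<in> sets lebesgue" "A = S \<inter> A'"
      by (auto simp: sets_restrict_space)
    then obtain B N N' where B: "A' = B \<union> N" "N \<subseteq> N'" "N' \<in> null_sets lborel" "B \<in> sets lborel"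
      by (metis sets_completionE)
    have "N' \<in> null_sets lebesgue" using B(3) by (rule null_sets_completionI)
    then have "AE x in lebesgue. x \<notin> N'" by (rule AE_not_in)
    then have AE: "AE x in ?N. x \<notin> N'"
      using S by (subst AE_restrict_space_iff) (auto simp: fmeasurableD)
    have "(\<integral>x. f n x * (indicator A x *\<^sub>R c) \<partial>?N) = (\<integral>x. f n x * indicator B x \<partial>?N) * c" for n
    proof -
      have "(\<integral>x. f n x * (indicator A x *\<^sub>R c) \<partial>?N) = (\<integral>x. f n x * indicator B x * c \<partial>?N)"
      proof (rule integral_cong_AE)
        show "AE x in ?N. f n x * (indicator A x *\<^sub>R c) = f n x * indicator B x * c"
          using AE AE_space by eventually_elim (use A' B in \<open>auto simp: indicator_def\<close>)
        show "(\<lambda>x. f n x * (indicator A x *\<^sub>R c)) \<in> borel_measurable ?N"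
          using base by measurable
        show "(\<lambda>x. f n x * indicator B x * c) \<in> borel_measurable ?N"
        proof -
          have [measurable]: "B \<in> sets borel" using B by simp
          show ?thesis by measurable
        qed
      qed
      then show ?thesis by simp
    qed
    then show ?case using tendsto_mult_right[OF borel[of B], of c] B by simp
  next
    case (add h1 h2)
    have "integrable ?N (\<lambda>x. f n x * h x)" if "integrable ?N h" for n h
    proof (rule Bochner_Integration.integrable_bound[OF that])
      show "(\<lambda>x. f n x * h x) \<in> borel_measurable ?N"
        using borel_measurable_integrable[OF that] by measurable
      show "AE x in ?N. norm (f n x * h x) \<le> norm (h x)"
        using f_le by (simp add: abs_mult mult_left_le_one_le)
    qed
    then show ?case using tendsto_add[OF add(3,4)] add(1,2) by (simp add: distrib_left)
  next
    case (lim h s)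
    show ?case
      by (rule weak_null_dominated_limit[where w = "\<lambda>x. 2 * norm (h x)" and s = s])
        (use lim f f_le in auto)
  qed
qed

lemma measure_unit_interval_Int:
  assumes "0 \<le> a" "a \<le> b" "b \<le> (1::real)"
  shows "measure (lebesgue_on {0<..<1}) ({a..<b} \<inter> {0<..<1}) = b - a"
proof -
  have "{a..<b} \<inter> {0<..<1} = (if a = 0 then {0<..<b} else {a..<b})"
    using assms by auto
  then have "measure lebesgue ({a..<b} \<inter> {0<..<1}) = b - a"
    using assms by (simp add: measure_completion)
  then show ?thesis
    by (subst measure_restrict_space) auto
qed

text \<open>On each cell of length \<open>1 / Suc n\<close>, the set \<open>E n\<close> is an initial segment of length equal to the
  integral of \<open>\<theta>\<close> over the cell, so \<open>indicator (E n) - \<theta>\<close> has mean zero on the cell.\<close>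

lemma indicators_weak_star_dense:
  fixes \<theta> :: "real \<Rightarrow> real"
  assumes \<theta> [measurable]: "\<theta> \<in> borel_measurable (lebesgue_on {0<..<1})"
    and \<theta>_ge: "\<And>x. 0 \<le> \<theta> x" and \<theta>_le: "\<And>x. \<theta> x \<le> 1"
  obtains E :: "nat \<Rightarrow> real set" where "\<And>n. E n \<in> sets borel"
    "\<And>g. integrable (lebesgue_on {0<..<1}) g \<Longrightarrow>
      (\<lambda>n. \<integral>x. (indicator (E n) x - \<theta> x) * g x \<partial>lebesgue_on {0<..<1}) \<longlonglongrightarrow> 0"
proof -
  let ?N = "lebesgue_on {0<..<1::real}"
  interpret N: finite_measure ?N
    by (rule finite_measure_lebesgue_on) auto
  define \<tau> where "\<tau> n j
    = (\<integral>x. \<theta> x * indicator {real_of_int j / Suc n..<(real_of_int j + 1) / Suc n} x \<partial>?N)"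
    for n :: nat and j :: int
  define E where "E n = {x. x - real_of_int \<lfloor>real (Suc n) * x\<rfloor> / Suc n < \<tau> n \<lfloor>real (Suc n) * x\<rfloor>}"
    for n :: nat
  define f where "f n x = indicator (E n) x - \<theta> x" for n x
  have E [measurable]: "E n \<in> sets borel" for n
    unfolding E_def by measurable
  have ind [measurable]: "(indicator A :: real \<Rightarrow> real) \<in> borel_measurable ?N" if "A \<in> sets borel"
    for A
    using that by (intro measurable_restrict_space1 borel_measurable_indicator) auto
  have f [measurable]: "f n \<in> borel_measurable ?N" for n
    unfolding f_def by measurable
  have f_le: "\<bar>f n x\<bar> \<le> 1" for n x
    using \<theta>_ge[of x] \<theta>_le[of x] by (auto simp: f_def indicator_def)
  have int: "integrable ?N (\<lambda>x. h x * indicator A x)"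
    if "A \<in> sets borel" "h \<in> borel_measurable ?N" "\<And>x. \<bar>h x\<bar> \<le> 1" for h :: "real \<Rightarrow> real" and A
  proof (rule N.integrable_const_bound[where B = 1])
    show "(\<lambda>x. h x * indicator A x) \<in> borel_measurable ?N"
      using that by measurable
    show "AE x in ?N. norm (h x * indicator A x) \<le> 1"
      by (rule AE_I2) (use that in \<open>auto simp: indicator_def\<close>)
  qed
  have meas: "(\<integral>x. indicator {a..<b} x \<partial>?N) = b - a" if "0 \<le> a" "a \<le> b" "b \<le> 1" for a b
    using measure_unit_interval_Int[OF that] by simp
  have bound: "\<bar>\<integral>x. h x * indicator {a..<b} x \<partial>?N\<bar> \<le> b - a"
    if "0 \<le> a" "a \<le> b" "b \<le> 1" and h: "h \<in> borel_measurable ?N" "\<And>x. \<bar>h x\<bar> \<le> 1"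
    for h :: "real \<Rightarrow> real" and a b
  proof -
    have "\<bar>\<integral>x. h x * indicator {a..<b} x \<partial>?N\<bar> \<le> (\<integral>x. \<bar>h x * indicator {a..<b} x\<bar> \<partial>?N)"
      by (rule integral_abs_bound)
    also have "\<dots> \<le> (\<integral>x. 1 * indicator {a..<b} x \<partial>?N)"
      by (intro integral_mono integrable_abs int) (use h in \<open>auto simp: indicator_def\<close>)
    also have "\<dots> = b - a" using meas[OF that(1-3)] by simp
    finally show ?thesis .
  qed
  \<comment> \<open>\<open>F n\<close> is the primitive of \<open>f n\<close>. Mean zero on each
    cell makes it vanish at the nodes, and \<open>f n\<close> being bounded by 1 then keeps it below
    the cell length everywhere; this is all the convergence that initial segments need.\<close>
  define F where "F n t = (\<integral>x. f n x * indicator {..<t} x \<partial>?N)" for n t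
  have F_diff: "F n b - F n a = (\<integral>x. f n x * indicator {a..<b} x \<partial>?N)" if "a \<le> b" for n a b
  proof -
    have "F n b - F n a = (\<integral>x. f n x * indicator {..<b} x - f n x * indicator {..<a} x \<partial>?N)"
      unfolding F_def by (intro Bochner_Integration.integral_diff[symmetric] int) (use f_le in auto)
    also have "\<dots> = (\<integral>x. f n x * indicator {a..<b} x \<partial>?N)"
      by (rule Bochner_Integration.integral_cong) (use that in \<open>auto simp: indicator_def\<close>)
    finally show ?thesis .
  qed
  have F_le_0: "F n t = 0" if "t \<le> 0" for n t
    unfolding F_def by (subst Bochner_Integration.integral_cong[where g = "\<lambda>x. 0"])
      (use that in \<open>auto simp: indicator_def\<close>)
  have F_ge_1: "F n t = (\<integral>x. f n x \<partial>?N)" if "t \<ge> 1" for n t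
    unfolding F_def by (rule Bochner_Integration.integral_cong)
      (use that in \<open>auto simp: indicator_def\<close>)
  have cell: "F n ((real j + 1) / Suc n) = F n (real j / Suc n)" if "j < Suc n" for n j
  proof -
    let ?a = "real j / Suc n" and ?b = "(real j + 1) / Suc n"
    have ab: "0 \<le> ?a" "?a \<le> ?b" "?b \<le> 1" using that by (auto simp: field_simps)
    have fl: "\<lfloor>real (Suc n) * x\<rfloor> = int j" if "x \<in> {?a..<?b}" for x
      using that by (simp add: floor_eq_iff field_simps)
    have \<tau>: "\<tau> n (int j) = (\<integral>x. \<theta> x * indicator {?a..<?b} x \<partial>?N)"
      by (simp add: \<tau>_def)
    have "\<tau> n (int j) \<ge> 0"
      unfolding \<tau> by (rule integral_nonneg_AE) (use \<theta>_ge in auto)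
    \<comment> \<open>Because \<theta> is at most 1, the prescribed segment fits into its
      cell.\<close>
    moreover have "\<tau> n (int j) \<le> ?b - ?a"
      unfolding \<tau> using bound[OF ab \<theta>] \<theta>_ge \<theta>_le by force
    ultimately have \<tau>_le: "0 \<le> \<tau> n (int j)" "?a + \<tau> n (int j) \<le> ?b" by auto
    have "F n ?b - F n ?a = (\<integral>x. indicator (E n) x * indicator {?a..<?b} x - \<theta> x * indicator
      {?a..<?b} x \<partial>?N)"
      using F_diff[OF ab(2)] by (simp add: f_def left_diff_distrib)
    also have "\<dots> = (\<integral>x. indicator (E n) x * indicator {?a..<?b} x \<partial>?N) - \<tau> n (int j)"
      unfolding \<tau> by (intro Bochner_Integration.integral_diff int)
        (use ind[OF E] \<theta> \<theta>_ge \<theta>_le in \<open>auto split: split_indicator\<close>)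
    also have "(\<integral>x. indicator (E n) x * indicator {?a..<?b} x \<partial>?N)
        = (\<integral>x. indicator {?a..<?a + \<tau> n (int j)} x \<partial>?N :: real)"
    proof (rule Bochner_Integration.integral_cong)
      fix x
      show "indicator (E n) x * indicator {?a..<?b} x
        = (indicator {?a..<?a + \<tau> n (int j)} x :: real)"
        using fl[of x] \<tau>_le by (cases "x \<in> {?a..<?b}") (auto simp: E_def indicator_def)
    qed simp
    also have "\<dots> = \<tau> n (int j)"
      using meas[of ?a "?a + \<tau> n (int j)"] ab \<tau>_le by linarith
    finally show ?thesis by simp
  qed
  have F_node: "F n (real j / Suc n) = 0" if "j \<le> Suc n" for n j
    using that
  proof (induction j)
    case 0
    then show ?case using F_le_0[of 0] by simp
  next
    case (Suc j)
    then show ?case using cell[of j n] by (simp add: add.commute)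
  qed
  have F_bound: "\<bar>F n t\<bar> \<le> 1 / Suc n" for n t
  proof -
    consider "t \<le> 0" | "t \<ge> 1" | "0 < t" "t < 1" by linarith
    then show ?thesis
    proof cases
      case 1
      then show ?thesis using F_le_0 by simp
    next
      case 2
      then show ?thesis using F_ge_1[of t] F_ge_1[of 1] F_node[of "Suc n" n] by simp
    next
      case 3
      define j where "j = nat \<lfloor>real (Suc n) * t\<rfloor>"
      have "\<lfloor>real (Suc n) * t\<rfloor> \<ge> 0" using 3 by simp
      then have j: "real j \<le> real (Suc n) * t" "real (Suc n) * t < real j + 1"
        unfolding j_def by linarith+
      then have "real j / Suc n \<le> t" "t \<le> (real j + 1) / Suc n"
        by (simp_all add: pos_divide_le_eq pos_le_divide_eq mult.commute del: of_nat_Suc)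
      then have jt: "real j / Suc n \<le> t" "t - real j / Suc n \<le> 1 / Suc n"
        by (simp_all add: add_divide_distrib)
      have "real (Suc n) * t < Suc n" using 3 by simp
      then have "j \<le> Suc n" using j by linarith
      then have "F n t = (\<integral>x. f n x * indicator {real j / Suc n..<t} x \<partial>?N)"
        using F_node F_diff[OF jt(1), of n] by simp
      then have "\<bar>F n t\<bar> \<le> t - real j / Suc n"
        using bound[of "real j / Suc n" t "f n"] jt 3 f f_le by simp
      then show ?thesis using jt by linarith
    qed
  qed
  have F_lim: "(\<lambda>n. F n t) \<longlonglongrightarrow> 0" for t
    by (rule Lim_null_comparison[OF _ LIMSEQ_inverse_real_of_nat])
      (use F_bound in \<open>auto simp: inverse_eq_divide\<close>)
  have "(\<lambda>n. \<integral>x. f n x * g x \<partial>?N) \<longlonglongrightarrow> 0" if "integrable ?N g" for g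
  proof (rule weak_null_if_initial_segments[OF _ f f_le _ _ that])
    show "{0<..<1::real} \<in> lmeasurable" by simp
    show "(\<lambda>n. \<integral>x. f n x * indicator {..<t} x \<partial>?N) \<longlonglongrightarrow> 0" for t
      using F_lim[of t] by (simp only: F_def)
    show "(\<lambda>n. \<integral>x. f n x \<partial>?N) \<longlonglongrightarrow> 0"
      using F_lim[of 1] by (simp only: F_ge_1 order_refl)
  qed
  then show thesis
    unfolding f_def by (rule that[OF E])
qed

section \<open>Cutoff to the inner intervals and weak* limits of two-valued mixtures\<close>

lemma inner_ival_subset: "inner_ival n \<subseteq> unit_ival"
proof
  fix x assume "x \<in> inner_ival n"
  \<comment> \<open>This includes n = 0, where 1 / 0 = 0 and the inner interval is the whole unit
    interval.\<close>
  moreover have "0 \<le> 1 / real n" by simp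
  ultimately show "x \<in> unit_ival" unfolding inner_ival_def greaterThanLessThan_iff by linarith
qed

lemma eventually_in_inner_ival:
  assumes "x \<in> unit_ival"
  shows "\<forall>\<^sub>F n in sequentially. x \<in> inner_ival n"
proof -
  have "\<forall>\<^sub>F n in sequentially. 1 / real n < min x (1 - x)"
    using assms by (intro order_tendstoD(2)[OF lim_1_over_n]) auto
  then show ?thesis by eventually_elim (auto simp: inner_ival_def)
qed

lemma inner_ival_borel [measurable]: "inner_ival n \<in> sets borel"
  by (simp add: inner_ival_def)

lemma integrable_bounded_inner:
  fixes f g :: "'a \<Rightarrow> 'b::euclidean_space"
  assumes f [measurable]: "f \<in> borel_measurable M" and f_le: "AE x in M. norm (f x) \<le> R"
    and g: "integrable M g"
  shows "integrable M (\<lambda>x. f x \<bullet> g x)"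
proof (rule Bochner_Integration.integrable_bound)
  show "integrable M (\<lambda>x. R * norm (g x))" using g by simp
  show "(\<lambda>x. f x \<bullet> g x) \<in> borel_measurable M"
    using borel_measurable_integrable[OF g] by measurable
  show "AE x in M. norm (f x \<bullet> g x) \<le> norm (R * norm (g x))"
    using f_le
  proof eventually_elim
    case (elim x)
    have "\<bar>f x \<bullet> g x\<bar> \<le> norm (f x) * norm (g x)" by (rule Cauchy_Schwarz_ineq2)
    also have "\<dots> \<le> R * norm (g x)" using elim by (intro mult_right_mono) auto
    finally show ?case by simp
  qed
qed

lemma AE_lebesgue_on_subset:
  assumes "AE x in lebesgue_on S. P x" "T \<subseteq> S" "S \<in> sets lebesgue" "T \<in> sets lebesgue"
  shows "AE x in lebesgue_on T. P x"
proof -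
  have "AE x in lebesgue. x \<in> S \<longrightarrow> P x"
    using assms by (subst (asm) AE_restrict_space_iff) auto
  then have "AE x in lebesgue. x \<in> T \<longrightarrow> P x"
    using assms(2) by (auto elim!: eventually_mono)
  then show ?thesis using assms by (subst AE_restrict_space_iff) auto
qed

lemma Linfty_on_cong:
  assumes "\<And>x. x \<in> S \<Longrightarrow> f x = g x"
  shows "f \<in> Linfty_on S V \<longleftrightarrow> g \<in> Linfty_on S V"
proof -
  have "f \<in> borel_measurable (lebesgue_on S) \<longleftrightarrow> g \<in> borel_measurable (lebesgue_on S)"
    by (rule measurable_cong) (simp add: assms)
  moreover have "(AE x in lebesgue_on S. norm (f x) \<le> C) \<longleftrightarrow> (AE x in lebesgue_on S. norm (g x) \<le> C)"
    for C
    by (rule AE_cong) (simp add: assms)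
  ultimately show ?thesis by (simp add: Linfty_on_def assms)
qed

text \<open>Apart from what the cutoff removes, mixture minus limit tested with \<phi> equals
  \<open>indicator (E n) - \<theta>\<close> times the scalar function \<open>(A - B)\<close> tested
  with \<phi>, which is integrable. So the scalar statement \<open>lim\<close> is enough for
  matrix-valued test functions.\<close>

lemma oscillating_mixture_weak_star:
  fixes A B X \<phi> :: "real \<Rightarrow> 'a::euclidean_space" and \<theta> :: "real \<Rightarrow> real"
  assumes A [measurable]: "A \<in> borel_measurable (lebesgue_on unit_ival)"
    and B [measurable]: "B \<in> borel_measurable (lebesgue_on unit_ival)"
    and A_le: "AE x in lebesgue_on unit_ival. norm (A x) \<le> R"
    and B_le: "AE x in lebesgue_on unit_ival. norm (B x) \<le> R"
    and X [measurable]: "X \<in> borel_measurable (lebesgue_on unit_ival)"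
    and X_le: "AE x in lebesgue_on unit_ival. norm (X x) \<le> R"
    and X_eq: "\<And>x. x \<in> unit_ival \<Longrightarrow> X x = \<theta> x *\<^sub>R A x + (1 - \<theta> x) *\<^sub>R B x"
    and E [measurable]: "\<And>n. E n \<in> sets borel"
    and lim: "\<And>g. integrable (lebesgue_on unit_ival) g \<Longrightarrow>
      (\<lambda>n. \<integral>x. (indicator (E n) x - \<theta> x) * g x \<partial>lebesgue_on unit_ival) \<longlonglongrightarrow> 0"
    and \<phi>: "integrable (lebesgue_on unit_ival) \<phi>"
  shows "(\<lambda>n. \<integral>x. (if x \<in> inner_ival n then
    if x \<in> E n then A x else B x else 0) \<bullet> \<phi> x \<partial>lebesgue_on unit_ival)
    \<longlonglongrightarrow> (\<integral>x. X x \<bullet> \<phi> x \<partial>lebesgue_on unit_ival)"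
proof -
  let ?N = "lebesgue_on unit_ival"
  have sets [measurable]: "{x \<in> space ?N. x \<in> S} \<in> sets ?N" if "S \<in> sets borel" for S
    using that by (auto simp: sets_restrict_space image_iff intro!: bexI[of _ S])
  define C where "C n x = (if x \<in> E n then A x else B x)" for n x
  define P where "P n x = (if x \<in> inner_ival n then C n x else 0)" for n x
  \<comment> \<open>The part lost by the cutoff. It tends to 0 in integral since every point
    eventually lies in the inner interval.\<close>
  define r where "r n x = (if x \<in> inner_ival n then 0 else C n x \<bullet> \<phi> x)" for n x
  have C [measurable]: "C n \<in> borel_measurable ?N" for n
    unfolding C_def by measurable
  have P [measurable]: "P n \<in> borel_measurable ?N" for n
    unfolding P_def by measurable
  have \<phi>' [measurable]: "\<phi> \<in> borel_measurable ?N"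
    using \<phi> by (rule borel_measurable_integrable)
  have C_le: "AE x in ?N. norm (C n x) \<le> R" for n
    using A_le B_le by eventually_elim (simp add: C_def)
  have P_le: "AE x in ?N. norm (P n x) \<le> R" for n
    using C_le[of n] by eventually_elim (auto simp: P_def intro: order_trans[OF norm_ge_zero])
  note int_A = integrable_bounded_inner[OF A A_le \<phi>]
  note int_B = integrable_bounded_inner[OF B B_le \<phi>]
  note int_X = integrable_bounded_inner[OF X X_le \<phi>]
  note int_P = integrable_bounded_inner[OF P P_le \<phi>]
  have r_meas [measurable]: "r n \<in> borel_measurable ?N" for n
    unfolding r_def by measurable
  have r_bound: "AE x in ?N. norm (r n x) \<le> norm (R * norm (\<phi> x))" for n
    using C_le[of n]
  proof eventually_elim
    case (elim x)
    have "\<bar>C n x \<bullet> \<phi> x\<bar> \<le> norm (C n x) * norm (\<phi> x)" by (rule Cauchy_Schwarz_ineq2)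
    also have "\<dots> \<le> R * norm (\<phi> x)" using elim by (intro mult_right_mono) auto
    finally show ?case
      using order_trans[OF abs_ge_zero] by (fastforce simp: r_def)
  qed
  have int_dom: "integrable ?N (\<lambda>x. norm (R * norm (\<phi> x)))" using \<phi> by simp
  have "(\<lambda>n. \<integral>x. r n x \<partial>?N) \<longlonglongrightarrow> (\<integral>x. 0 \<partial>?N)"
  proof (rule integral_dominated_convergence[OF _ _ int_dom])
    show "AE x in ?N. (\<lambda>n. r n x) \<longlonglongrightarrow> 0"
    proof (rule AE_I2)
      fix x assume "x \<in> space ?N"
      then have "\<forall>\<^sub>F n in sequentially. r n x = 0"
        using eventually_in_inner_ival[of x] by (auto elim!: eventually_mono simp: r_def)
      then show "(\<lambda>n. r n x) \<longlonglongrightarrow> 0" by (rule tendsto_eventually)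
    qed
  qed (use r_bound r_meas in auto)
  then have r0: "(\<lambda>n. \<integral>x. r n x \<partial>?N) \<longlonglongrightarrow> 0" by simp
  have int_r: "integrable ?N (r n)" for n
    by (rule Bochner_Integration.integrable_bound[OF int_dom]) (use r_bound r_meas in auto)
  define g where "g x = A x \<bullet> \<phi> x - B x \<bullet> \<phi> x" for x
  have int_g: "integrable ?N g" unfolding g_def using int_A int_B by simp
  have pw: "P n x \<bullet> \<phi> x - X x \<bullet> \<phi> x + r n x = (indicator (E n) x - \<theta> x) * g x"
    if "x \<in> unit_ival" for n x
    by (auto simp: P_def C_def r_def g_def X_eq[OF that] inner_add_left inner_diff_left
      algebra_simps indicator_def)
  have "(\<integral>x. P n x \<bullet> \<phi> x \<partial>?N) - (\<integral>x. X x \<bullet> \<phi> x \<partial>?N) + (\<integral>x. r n x \<partial>?N)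
    = (\<integral>x. (indicator (E n) x - \<theta> x) * g x \<partial>?N)" for n
  proof -
    have "(\<integral>x. (indicator (E n) x - \<theta> x) * g x \<partial>?N) = (\<integral>x. P n x \<bullet> \<phi> x - X x \<bullet> \<phi> x + r n x \<partial>?N)"
      by (rule Bochner_Integration.integral_cong) (simp_all add: pw)
    also have "\<dots> = (\<integral>x. P n x \<bullet> \<phi> x \<partial>?N) - (\<integral>x. X x \<bullet> \<phi> x \<partial>?N) + (\<integral>x. r n x \<partial>?N)"
      using int_P[of n] int_X int_r[of n] by simp
    finally show ?thesis ..
  qed
  then have "(\<integral>x. P n x \<bullet> \<phi> x \<partial>?N) = (\<integral>x. X x \<bullet> \<phi> x \<partial>?N)
      + ((\<integral>x. (indicator (E n) x - \<theta> x) * g x \<partial>?N) - (\<integral>x. r n x \<partial>?N))" for n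
    by (simp add: algebra_simps)
  moreover have "(\<lambda>n. (\<integral>x. X x \<bullet> \<phi> x \<partial>?N)
      + ((\<integral>x. (indicator (E n) x - \<theta> x) * g x \<partial>?N) - (\<integral>x. r n x \<partial>?N)))
    \<longlonglongrightarrow> (\<integral>x. X x \<bullet> \<phi> x \<partial>?N) + (0 - 0)"
    by (intro tendsto_add tendsto_diff tendsto_const lim int_g r0)
  ultimately have "(\<lambda>n. \<integral>x. P n x \<bullet> \<phi> x \<partial>?N) \<longlonglongrightarrow> (\<integral>x. X x \<bullet> \<phi> x \<partial>?N)" by simp
  then show ?thesis by (simp only: P_def C_def)
qed

section \<open>The frame and the quadratic forms\<close>

definition rot :: "real ^ 2 \<Rightarrow> real ^ 2" where
  "rot e = vector [- e $ 2, e $ 1]"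

text \<open>This is the map L_t in the vector coordinates, written as an explicit polynomial in the
  tangent. The third coordinate is halved because it stands for twice the mixed coefficient.\<close>

definition frame_embed :: "real ^ 2 \<Rightarrow> real ^ 3 \<Rightarrow> real ^ 2 ^ 2" where
  "frame_embed e w = w $ 1 *\<^sub>R outer e e + w $ 2 *\<^sub>R outer (rot e) (rot e)
     + (w $ 3 / 2) *\<^sub>R (outer e (rot e) + outer (rot e) e)"

lemma rot_nth [simp]: "rot e $ 1 = - e $ 2" "rot e $ 2 = e $ 1"
  by (simp_all add: rot_def)

lemma outer_nth [simp]: "outer p q $ i $ j = p $ i * q $ j"
  by (simp add: outer_def)

lemma sym_mat_iff: "A \<in> sym_mat \<longleftrightarrow> A $ 2 $ 1 = A $ 1 $ 2"
  by (auto simp: sym_mat_def vec_eq_iff transpose_def forall_2)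

lemma subspace_sym_mat: "subspace sym_mat"
  by (simp add: subspace_def sym_mat_iff)

lemma norm_2_eq_1: "norm (e :: real ^ 2) = 1 \<longleftrightarrow> e $ 1 * e $ 1 + e $ 2 * e $ 2 = 1"
  by (simp add: norm_eq_1 inner_vec_def sum_2)

lemma frame_embed_sym: "frame_embed e w \<in> sym_mat"
  by (simp add: frame_embed_def sym_mat_iff)

lemma linear_frame_embed: "linear (frame_embed e)"
  by (rule linearI) (simp_all add: frame_embed_def vec_eq_iff forall_2 algebra_simps
    add_divide_distrib)

text \<open>For arbitrary \<open>e\<close> the two sides differ by the fourth power of the norm of
  \<open>e\<close>, the squared determinant of the matrix with columns \<open>e\<close> and
  \<open>rot e\<close>. Stating this as a polynomial identity first and normalizing last is also the
  pattern of the next two lemmas.\<close>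

lemma det_frame_embed:
  assumes "norm e = 1"
  shows "det (frame_embed e w) = w $ 1 * w $ 2 - w $ 3 ^ 2 / 4"
proof -
  have "det (frame_embed e w)
    = (e $ 1 * e $ 1 + e $ 2 * e $ 2) ^ 2 * (w $ 1 * w $ 2 - w $ 3 ^ 2 / 4)"
    by (simp add: frame_embed_def det_2 power2_eq_square field_simps)
  then show ?thesis using assms by (simp add: norm_2_eq_1)
qed

lemma frame_embed_tangential:
  assumes "norm e = 1"
  shows "e \<bullet> (frame_embed e w *v e) = w $ 1" "e \<bullet> (frame_embed e w *v rot e) = w $ 3 / 2"
    "rot e \<bullet> (frame_embed e w *v rot e) = w $ 2"
proof -
  let ?n = "e $ 1 * e $ 1 + e $ 2 * e $ 2"
  have n: "?n = 1" using assms by (simp add: norm_2_eq_1)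
  have "e \<bullet> (frame_embed e w *v e) = ?n ^ 2 * w $ 1"
    by (simp add: frame_embed_def inner_vec_def matrix_vector_mult_def sum_2 power2_eq_square
      field_simps)
  moreover have "e \<bullet> (frame_embed e w *v rot e) = ?n ^ 2 * (w $ 3 / 2)"
    by (simp add: frame_embed_def inner_vec_def matrix_vector_mult_def sum_2 power2_eq_square
      field_simps)
  moreover have "rot e \<bullet> (frame_embed e w *v rot e) = ?n ^ 2 * w $ 2"
    by (simp add: frame_embed_def inner_vec_def matrix_vector_mult_def sum_2 power2_eq_square
      field_simps)
  ultimately show "e \<bullet> (frame_embed e w *v e) = w $ 1" "e \<bullet> (frame_embed e w *v rot e) = w $ 3 / 2"
    "rot e \<bullet> (frame_embed e w *v rot e) = w $ 2" using n by simp_all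
qed

lemma frame_embed_coords:
  assumes e: "norm e = 1" and X: "X \<in> sym_mat"
  shows "frame_embed e (vector [e \<bullet> (X *v e), rot e \<bullet> (X *v rot e), 2 * (e \<bullet> (X *v rot e))]) = X"
proof -
  let ?n = "e $ 1 * e $ 1 + e $ 2 * e $ 2"
  have n: "?n = 1" using e by (simp add: norm_2_eq_1)
  have s: "X $ 2 $ 1 = X $ 1 $ 2" using X by (simp add: sym_mat_iff)
  have "frame_embed e (vector [e \<bullet> (X *v e), rot e \<bullet> (X *v rot e), 2 * (e \<bullet> (X *v rot e))])
    = ?n ^ 2 *\<^sub>R X"
    unfolding vec_eq_iff forall_2
    by (simp add: frame_embed_def inner_vec_def matrix_vector_mult_def sum_2 s power2_eq_square
      field_simps)
  then show ?thesis using n by simp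
qed

section \<open>Frame, coefficients and stiffness matrix expressed through \<open>rot\<close> and
  \<open>frame_embed\<close>\<close>

lemma normal_vec_eq: "normal_vec chi t = rot (tangent chi t)"
  by (simp add: normal_vec_def unembed3_def embed3_def cross3_def rot_def axis_def vec_eq_iff
    forall_2)

lemma matrix_inv_eqI:
  fixes A :: "'a::semiring_1 ^ 'n ^ 'm"
  assumes "A ** B = mat 1" "B ** A = mat 1"
  shows "matrix_inv A = B"
  unfolding matrix_inv_def
proof (rule some_equality)
  fix C assume "A ** C = mat 1 \<and> C ** A = mat 1"
  then have "B ** (A ** C) = B" "(B ** A) ** C = C" using assms by simp_all
  then show "C = B" by (simp add: matrix_mul_assoc)
qed (use assms in auto)

text \<open>The frame matrix \<open>R\<close> is orthogonal, so its inverse is its transpose and the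
  map becomes the congruence of \<open>C\<close> by \<open>R\<close>.\<close>

lemma L_map_sym_of_vec:
  assumes "norm (tangent chi t) = 1"
  shows "L_map chi t (sym_of_vec w) = frame_embed (tangent chi t) w"
proof -
  let ?R = "frame_mat chi t"
  define e where "e = tangent chi t"
  have R: "?R $ 1 $ 1 = e $ 1" "?R $ 1 $ 2 = - e $ 2" "?R $ 2 $ 1 = e $ 2" "?R $ 2 $ 2 = e $ 1"
    by (simp_all add: frame_mat_def e_def normal_vec_eq transpose_def)
  have n: "e $ 1 * e $ 1 + e $ 2 * e $ 2 = 1" using assms by (simp add: norm_2_eq_1 e_def)
  have "?R ** transpose ?R = mat 1" "transpose ?R ** ?R = mat 1"
    using n by (simp_all add: vec_eq_iff forall_2 matrix_matrix_mult_def sum_2 R transpose_def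
      mat_def algebra_simps)
  then have inv: "matrix_inv ?R = transpose ?R"
    by (rule matrix_inv_eqI)
  show ?thesis
    unfolding L_map_def inv transpose_transpose e_def[symmetric]
    by (simp add: vec_eq_iff forall_2 matrix_matrix_mult_def sum_2 R transpose_def sym_of_vec_def
        frame_embed_def algebra_simps)
qed

text \<open>Testing an expansion against \<open>e\<close> and \<open>rot e\<close> recovers its
  coefficients; this gives the uniqueness required by the definite description.\<close>

lemma frame_coeffs_sym:
  assumes e: "norm (tangent chi t) = 1" and X: "X \<in> sym_mat"
  shows "frame_coeffs chi t X $ 1 $ 1 = tangent chi t \<bullet> (X *v tangent chi t)"
    "frame_coeffs chi t X $ 1 $ 2 = tangent chi t \<bullet> (X *v rot (tangent chi t))"
proof -
  let ?e = "tangent chi t"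
  define w :: "real ^ 3" where
    "w = vector [?e \<bullet> (X *v ?e), rot ?e \<bullet> (X *v rot ?e), 2 * (?e \<bullet> (X *v rot ?e))]"
  have X_eq: "X = frame_embed ?e w"
    unfolding w_def using frame_embed_coords[OF e X] by simp
  have expand: "C $ 1 $ 1 *\<^sub>R outer ?e ?e + C $ 1 $ 2 *\<^sub>R (outer ?e (rot ?e) + outer (rot ?e) ?e)
       + C $ 2 $ 2 *\<^sub>R outer (rot ?e) (rot ?e)
      = frame_embed ?e (vector [C $ 1 $ 1, C $ 2 $ 2, 2 * C $ 1 $ 2])" for C :: "real ^ 2 ^ 2"
    by (simp add: frame_embed_def)
  have "frame_coeffs chi t X = sym_of_vec w"
    unfolding frame_coeffs_def normal_vec_eq expand
  proof (rule the_equality)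
    have "vector [sym_of_vec w $ 1 $ 1, sym_of_vec w $ 2 $ 2, 2 * sym_of_vec w $ 1 $ 2] = w"
      by (simp add: sym_of_vec_def vec_eq_iff forall_3)
    then show "sym_of_vec w \<in> sym_mat \<and> X
      = frame_embed ?e (vector [sym_of_vec w $ 1 $ 1, sym_of_vec w $ 2 $ 2, 2 * sym_of_vec w $ 1 $
        2])"
      using X_eq by (simp add: sym_mat_iff sym_of_vec_def)
  next
    fix C assume C: "C \<in> sym_mat \<and> X
      = frame_embed ?e (vector [C $ 1 $ 1, C $ 2 $ 2, 2 * C $ 1 $ 2])"
    then have eq: "frame_embed ?e (vector [C $ 1 $ 1, C $ 2 $ 2, 2 * C $ 1 $ 2]) = frame_embed ?e w"
      using X_eq by simp
    have "C $ 1 $ 1 = w $ 1" "C $ 2 $ 2 = w $ 2" "C $ 1 $ 2 = w $ 3 / 2"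
      using frame_embed_tangential[OF e, of
        "vector [C $ 1 $ 1, C $ 2 $ 2, 2 * C $ 1 $ 2]", unfolded eq]
        frame_embed_tangential[OF e, of w] by simp_all
    then show "C = sym_of_vec w"
      using C by (simp add: sym_of_vec_def vec_eq_iff forall_2 sym_mat_iff)
  qed
  then show "frame_coeffs chi t X $ 1 $ 1 = ?e \<bullet> (X *v ?e)"
    "frame_coeffs chi t X $ 1 $ 2 = ?e \<bullet> (X *v rot ?e)"
    by (simp_all add: sym_of_vec_def w_def)
qed

text \<open>Polarization. It yields the uniqueness of the matrix described by
  \<open>K_mat\<close>.\<close>

lemma symmetric_matrix_eq_0:
  fixes S :: "real ^ 'n ^ 'n"
  assumes S: "transpose S = S" and q: "\<And>w. w \<bullet> (S *v w) = 0"
  shows "S = 0"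
proof -
  have "x \<bullet> (S *v y) = 0" for x y
  proof -
    have "y \<bullet> (S *v x) = x \<bullet> (S *v y)"
      by (metis S dot_lmul_matrix inner_commute transpose_matrix_vector)
    then show ?thesis
      using q[of "x + y"] q[of x] q[of y]
      by (simp add: matrix_vector_right_distrib inner_add_left inner_add_right)
  qed
  then have "S *v y = 0" for y by (metis inner_eq_zero_iff)
  then show ?thesis by (metis matrix_eq matrix_vector_mult_0)
qed

lemma det_mat_quadratic: "w \<bullet> (det_mat *v w) = w $ 1 * w $ 2 - w $ 3 ^ 2 / 4"
  by (simp add: det_mat_def inner_vec_def matrix_vector_mult_def sum_3 power2_eq_square)

lemma K_mat_spec:
  assumes e: "norm (tangent chi t) = 1" and Q: "quadratic_form_on sym_mat Q"
  shows "transpose (K_mat chi Q t) = K_mat chi Q t"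
    and "Q (frame_embed (tangent chi t) w) = w \<bullet> (K_mat chi Q t *v w)"
proof -
  let ?E = "frame_embed (tangent chi t)"
  obtain b where b: "bilinear b" and Qb: "\<And>X. X \<in> sym_mat \<Longrightarrow> Q X = b X X"
    using Q by (auto simp: quadratic_form_on_def)
  \<comment> \<open>The bilinear form representing \<open>Q\<close> may be nonsymmetric;
    symmetrizing leaves the diagonal unchanged and makes \<open>K\<close> symmetric.\<close>
  define B where "B x y = (b (?E x) (?E y) + b (?E y) (?E x)) / 2" for x y
  have B: "bilinear B"
    unfolding B_def bilinear_def
    by (intro conjI allI linearI)
      (simp_all add: linear_add[OF linear_frame_embed] linear_scale[OF linear_frame_embed]
        bilinear_ladd[OF b] bilinear_radd[OF b] bilinear_lmul[OF b] bilinear_rmul[OF b] field_simps)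
  define K :: "real ^ 3 ^ 3" where "K = (\<chi> i j. B (axis i 1) (axis j 1))"
  have q: "Q_frame chi Q t (sym_of_vec w) = B w w" for w
    by (simp add: Q_frame_def L_map_sym_of_vec[OF e] Qb frame_embed_sym B_def)
  have BK: "B w w = w \<bullet> (K *v w)" for w
  proof -
    have "B w w = B (\<Sum>i\<in>UNIV. w $ i *\<^sub>R axis i 1) (\<Sum>j\<in>UNIV. w $ j *\<^sub>R axis j 1)"
      by (simp add: basis_expansion scalar_mult_eq_scaleR[symmetric])
    also have "\<dots> = (\<Sum>(i, j)\<in>UNIV \<times> UNIV. w $ i * (w $ j * B (axis i 1) (axis j 1)))"
      by (simp add: bilinear_sum[OF B] bilinear_lmul[OF B] bilinear_rmul[OF B] mult.left_commute)
    also have "\<dots> = w \<bullet> (K *v w)"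
      by (simp add: K_def inner_vec_def matrix_vector_mult_def sum_distrib_left
        sum.cartesian_product ac_simps)
    finally show ?thesis .
  qed
  have "transpose (K_mat chi Q t) = K_mat chi Q t \<and>
     (\<forall>w. Q_frame chi Q t (sym_of_vec w) = w \<bullet> (K_mat chi Q t *v w))"
    unfolding K_mat_def
  proof (rule theI)
    show K: "transpose K = K \<and> (\<forall>w. Q_frame chi Q t (sym_of_vec w) = w \<bullet> (K *v w))"
      using q BK by (simp add: K_def transpose_def B_def vec_eq_iff add.commute)
    fix K' assume K': "transpose K' = K' \<and> (\<forall>w. Q_frame chi Q t (sym_of_vec w) = w \<bullet> (K' *v w))"
    have "K' - K = 0"
    proof (rule symmetric_matrix_eq_0)
      show "transpose (K' - K) = K' - K"
        using K K' by (simp add: transpose_def vec_eq_iff)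
      show "w \<bullet> ((K' - K) *v w) = 0" for w
        using K K' by (simp add: matrix_vector_mult_diff_rdistrib inner_diff_right)
    qed
    then show "K' = K" by simp
  qed
  then show "transpose (K_mat chi Q t) = K_mat chi Q t"
    "Q (?E w) = w \<bullet> (K_mat chi Q t *v w)"
    by (simp_all add: Q_frame_def L_map_sym_of_vec[OF e])
qed

text \<open>In frame coordinates \<open>Q + a det\<close> is the form of a symmetric matrix that
  annihilates \<open>v\<close>, so the terms linear and quadratic in \<open>s\<close> vanish.
  Leaving \<open>a\<close> free covers both signs: \<open>a = alphaQ_plus Q\<close> and
  \<open>a = - alphaQ_minus Q\<close>.\<close>

lemma kernel_direction_invariance:
  assumes e: "norm (tangent chi t) = 1" and Q: "quadratic_form_on sym_mat Q"
    and v: "(K_mat chi Q t + a *\<^sub>R det_mat) *v v = 0" and X: "X \<in> sym_mat"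
  shows "Q (X + s *\<^sub>R frame_embed (tangent chi t) v) + a * det (X
    + s *\<^sub>R frame_embed (tangent chi t) v)
    = Q X + a * det X"
proof -
  let ?E = "frame_embed (tangent chi t)"
  let ?S = "K_mat chi Q t + a *\<^sub>R det_mat"
  obtain x where x: "X = ?E x"
    using frame_embed_coords[OF e X] by metis
  have S: "Q (?E w) + a * det (?E w) = w \<bullet> (?S *v w)" for w
    by (simp add: K_mat_spec(2)[OF e Q] det_frame_embed[OF e] matrix_vector_mult_add_rdistrib
        inner_add_right det_mat_quadratic flip: scaleR_matrix_vector_assoc)
  have "transpose det_mat = det_mat"
    by (simp add: det_mat_def vec_eq_iff forall_3 transpose_def)
  then have "transpose ?S = ?S"
    using K_mat_spec(1)[OF e Q] by (simp add: transpose_def vec_eq_iff)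
  then have "v \<bullet> (?S *v x) = x \<bullet> (?S *v v)"
    by (metis dot_lmul_matrix inner_commute transpose_matrix_vector)
  then have "(x + s *\<^sub>R v) \<bullet> (?S *v (x + s *\<^sub>R v)) = x \<bullet> (?S *v x)"
    using v by (simp add: matrix_vector_right_distrib inner_add_left inner_add_right
        matrix_vector_mult_scaleR)
  moreover have "X + s *\<^sub>R ?E v = ?E (x + s *\<^sub>R v)"
    by (simp add: x linear_add[OF linear_frame_embed] linear_scale[OF linear_frame_embed])
  ultimately show ?thesis
    by (simp only: S x)
qed

lemma frame_embed_eq_0_iff:
  assumes e: "norm e = 1"
  shows "frame_embed e w = 0 \<longleftrightarrow> w = 0"
proof
  assume 0: "frame_embed e w = 0"
  show "w = 0"
    using frame_embed_tangential[OF e, of w] unfolding 0 by (simp add: vec_eq_iff forall_3)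
qed (simp add: linear_0[OF linear_frame_embed])

lemma quadratic_form_on_0:
  assumes "quadratic_form_on S Q" "0 \<in> S"
  shows "Q 0 = 0"
proof -
  obtain b where "bilinear b" "\<forall>x\<in>S. Q x = b x x"
    using assms(1) unfolding quadratic_form_on_def by blast
  then show ?thesis using assms(2) by (simp add: bilinear_lzero)
qed

lemma zero_sym_mat: "0 \<in> sym_mat"
  by (simp add: sym_mat_iff)

text \<open>The arc-length hypothesis speaks of a column of the Jacobian, the frame of the
  derivative of the centerline; the chain rule along the first axis joins the two.\<close>

lemma C2_map_frame:
  assumes "C2_map chi"
  shows "tangent chi t = column 1 (D_mat chi t)" "continuous_on UNIV (D_mat chi)"
    "continuous_on UNIV (tangent chi)"
proof -
  obtain f' f'' where f': "\<And>x. (chi has_derivative blinfun_apply (f' x)) (at x)"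
    and f'': "\<And>x. (f' has_derivative blinfun_apply (f'' x)) (at x)"
    using assms unfolding C2_map_def by metis
  have vec: "vector [t, 0] = t *\<^sub>R (axis 1 1 :: real ^ 2)" for t
    by (simp add: vec_eq_iff forall_2 axis_def)
  have D: "D_mat chi t = matrix (blinfun_apply (f' (t *\<^sub>R axis 1 1)))" for t
    by (simp add: D_mat_def vec jacobian_def flip: frechet_derivative_at[OF f'])
  have T: "tangent chi t = blinfun_apply (f' (t *\<^sub>R axis 1 1)) (axis 1 1)" for t
  proof -
    have "((\<lambda>t. chi (t *\<^sub>R axis 1 1)) has_derivative (\<lambda>h. blinfun_apply (f' (t *\<^sub>R axis 1 1)) (h *\<^sub>R
      axis 1 1))) (at t)"
      by (rule has_derivative_compose[OF _ f']) (auto intro!: derivative_eq_intros)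
    then have "(centerline chi has_vector_derivative blinfun_apply (f' (t *\<^sub>R axis 1 1)) (axis 1 1))
      (at t)"
      unfolding has_vector_derivative_def centerline_def[abs_def] vec
        by (simp add: blinfun.scaleR_right)
    then show ?thesis unfolding tangent_def by (rule vector_derivative_at)
  qed
  show eq: "tangent chi t = column 1 (D_mat chi t)" for t
    unfolding D T by (simp add: column_def matrix_def)
  have cont: "continuous_on UNIV (\<lambda>t::real. f' (t *\<^sub>R axis 1 1))"
  proof (rule continuous_on_compose2[of UNIV f'])
    show "continuous_on UNIV f'"
      using f'' by (intro has_derivative_continuous_on) auto
  qed (auto intro!: continuous_intros)
  then show "continuous_on UNIV (D_mat chi)"
    unfolding D[abs_def] matrix_def by (intro continuous_intros)
  show "continuous_on UNIV (tangent chi)"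
    unfolding T[abs_def] using cont by (intro continuous_intros)
qed

lemma continuous_on_matrix_entries:
  fixes f :: "'a::topological_space \<Rightarrow> real ^ 'n ^ 'm"
  assumes "\<And>i j. continuous_on S (\<lambda>x. f x $ i $ j)"
  shows "continuous_on S f"
proof -
  have "continuous_on S (\<lambda>x. \<chi> i j. f x $ i $ j)"
    using assms by (intro continuous_on_vec_lambda)
  then show ?thesis by simp
qed

lemma continuous_on_frame_embed:
  assumes "continuous_on S f" "continuous_on S g"
  shows "continuous_on S (\<lambda>t. frame_embed (f t) (g t))"
proof (rule continuous_on_matrix_entries)
  fix i j :: 2
  have "continuous_on S (\<lambda>t. rot (f t) $ 1)" "continuous_on S (\<lambda>t. rot (f t) $ 2)"
    using assms by (auto intro!: continuous_intros)
  then have "continuous_on S (\<lambda>t. rot (f t) $ k)" for k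
    using exhaust_2[of k] by (elim disjE) simp_all
  then have "continuous_on S (\<lambda>t. \<chi> k. rot (f t) $ k)"
    by (intro continuous_on_vec_lambda)
  then have "continuous_on S (\<lambda>t. rot (f t))" by simp
  then show "continuous_on S (\<lambda>t. frame_embed (f t) (g t) $ i $ j)"
    using assms unfolding frame_embed_def vector_add_component vector_scaleR_component outer_nth
    by (intro continuous_intros) auto
qed

section \<open>Measurability of matrix-valued functions\<close>

lemma borel_measurable_matrix_entry [measurable (raw)]:
  fixes f :: "'a \<Rightarrow> real ^ 'n ^ 'm"
  assumes "f \<in> borel_measurable M"
  shows "(\<lambda>x. f x $ i $ j) \<in> borel_measurable M"
proof -
  have "continuous_on UNIV (\<lambda>A :: real ^ 'n ^ 'm. A $ i $ j)" by (intro continuous_intros)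
  from borel_measurable_continuous_on[OF this assms] show ?thesis .
qed

lemma borel_measurable_matrix_vector [measurable (raw)]:
  fixes f :: "'a \<Rightarrow> real ^ 'n ^ 'm"
  assumes "f \<in> borel_measurable M" "g \<in> borel_measurable M"
  shows "(\<lambda>x. f x *v g x) \<in> borel_measurable M"
proof (rule borel_measurable_continuous_Pair[OF assms])
  have "continuous_on UNIV (\<lambda>p :: (real ^ 'n ^ 'm) \<times> (real ^ 'n). \<chi> i. \<Sum>j\<in>UNIV. fst p $ i $ j * snd
    p $ j)"
    by (intro continuous_intros)
  then show "continuous_on UNIV (\<lambda>p :: (real ^ 'n ^ 'm) \<times> (real ^ 'n). fst p *v snd p)"
    by (simp add: matrix_vector_mult_def)
qed

lemma borel_measurable_det_2 [measurable (raw)]: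
  fixes f :: "'a \<Rightarrow> real ^ 2 ^ 2"
  assumes [measurable]: "f \<in> borel_measurable M"
  shows "(\<lambda>x. det (f x)) \<in> borel_measurable M"
  unfolding det_2 by measurable

section \<open>Splitting along a degenerate direction\<close>

lemma matrix_entry_le_norm: "\<bar>X $ i $ j\<bar> \<le> norm X" for X :: "real ^ 'n ^ 'm"
  using component_le_norm_cart[of "X $ i" j] Finite_Cartesian_Product.norm_nth_le[of X i]
    by linarith

lemma det_le_norm: "\<bar>det X\<bar> \<le> 2 * norm X ^ 2" for X :: "real ^ 2 ^ 2"
proof -
  have prod_le: "\<bar>X $ i $ j * X $ k $ l\<bar> \<le> norm X * norm X" for i j k l
    unfolding abs_mult by (intro mult_mono matrix_entry_le_norm) auto
  show ?thesis
    unfolding det_2 power2_eq_square using prod_le[of 1 1 2 2] prod_le[of 1 2 2 1] by linarith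
qed

text \<open>The polarization of the determinant: the coefficient of \<open>s\<close> in
  \<open>det (X + s V)\<close>.\<close>

definition mixed_det :: "real ^ 2 ^ 2 \<Rightarrow> real ^ 2 ^ 2 \<Rightarrow> real" where
  "mixed_det X V = X $ 1 $ 1 * V $ 2 $ 2
    + X $ 2 $ 2 * V $ 1 $ 1 - X $ 1 $ 2 * V $ 2 $ 1 - X $ 2 $ 1 * V $ 1 $ 2"

text \<open>The discriminant of the polynomial \<open>det (X + s V)\<close> in
  \<open>s\<close>.\<close>

definition pencil_discr :: "real ^ 2 ^ 2 \<Rightarrow> real ^ 2 ^ 2 \<Rightarrow> real" where
  "pencil_discr X V = mixed_det X V ^ 2 - 4 * det V * det X"

text \<open>For \<open>V = 0\<close> division by zero makes the roots \<open>0\<close> and the weight \<open>1 / 2\<close>, which is still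
  correct when \<open>det X = 0\<close>; hence the degenerate case of \<open>splits\<close>.\<close>

definition pencil_root :: "real \<Rightarrow> real ^ 2 ^ 2 \<Rightarrow> real ^ 2 ^ 2 \<Rightarrow> real" where
  "pencil_root \<sigma> X V = (\<sigma> * sqrt (pencil_discr X V) - mixed_det X V) / (2 * det V)"

text \<open>With roots \<open>s1\<close> for sign -1 and \<open>s2\<close> for sign 1, the weight of
  \<open>s1\<close> that gives mean zero is \<open>s2 / (s2 - s1)\<close>; inserting the root
  formula cancels \<open>det V\<close>.\<close>

definition split_weight :: "real ^ 2 ^ 2 \<Rightarrow> real ^ 2 ^ 2 \<Rightarrow> real" where
  "split_weight X V = 1 / 2 - mixed_det X V / (2 * sqrt (pencil_discr X V))"

definition splits :: "real ^ 2 ^ 2 \<Rightarrow> real ^ 2 ^ 2 \<Rightarrow> bool" where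
  "splits X V \<longleftrightarrow> det X * det V < 0 \<or> det X = 0 \<and> V = 0"

lemma det_pencil: "det (X + s *\<^sub>R V) = det X + s * mixed_det X V + s ^ 2 * det V"
  for X V :: "real ^ 2 ^ 2"
  by (simp add: det_2 mixed_det_def algebra_simps power2_eq_square)

lemma pencil_discr_pos:
  assumes "det X * det V < 0"
  shows "pencil_discr X V > 0"
proof -
  have "4 * det V * det X < 0" using assms by (simp add: mult.commute)
  then show ?thesis
    using zero_le_power2[of "mixed_det X V"] unfolding pencil_discr_def by linarith
qed

lemma det_pencil_root:
  assumes "splits X V" "\<sigma> ^ 2 = 1"
  shows "det (X + pencil_root \<sigma> X V *\<^sub>R V) = 0"
proof (cases "V = 0")
  case False
  then have neg: "det X * det V < 0" using assms by (auto simp: splits_def)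
  then have V: "det V \<noteq> 0" by auto
  have "sqrt (pencil_discr X V) ^ 2 = mixed_det X V ^ 2 - 4 * det V * det X"
    using pencil_discr_pos[OF neg] by (simp add: pencil_discr_def)
  moreover define r where "r = \<sigma> * sqrt (pencil_discr X V)"
  ultimately have r: "r ^ 2 = mixed_det X V ^ 2 - 4 * det V * det X"
    using assms by (simp add: power_mult_distrib)
  have root: "pencil_root \<sigma> X V = (r - mixed_det X V) / (2 * det V)"
    by (simp add: pencil_root_def r_def)
  \<comment> \<open>The factor \<open>4 * det V\<close> completes the square and clears the
    denominators.\<close>
  have "4 * det V * det (X + pencil_root \<sigma> X V *\<^sub>R V)
    = 4 * det V * det X + 2 * (r - mixed_det X V) * mixed_det X V + (r - mixed_det X V) ^ 2"
    unfolding det_pencil root using V by (simp add: field_simps power2_eq_square)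
  also have "\<dots> = 4 * det V * det X + r ^ 2 - mixed_det X V ^ 2"
    by (simp add: algebra_simps power2_eq_square)
  finally have "4 * det V * det (X + pencil_root \<sigma> X V *\<^sub>R V) = 0"
    by (simp add: r)
  then show ?thesis using V by simp
qed (use assms in \<open>auto simp: splits_def det_2\<close>)

text \<open>Determinants of opposite sign push the discriminant above the square of
  \<open>mixed_det\<close>, so the quotient in the weight has modulus at most 1.\<close>

lemma split_weight_bounds:
  assumes "splits X V"
  shows "0 \<le> split_weight X V" "split_weight X V \<le> 1"
proof -
  have "det X * det V \<le> 0" using assms by (auto simp: splits_def)
  then have "mixed_det X V ^ 2 \<le> pencil_discr X V"
    by (simp add: pencil_discr_def mult.commute mult.left_commute)
  then have "\<bar>mixed_det X V\<bar> \<le> sqrt (pencil_discr X V)"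
    by (metis real_sqrt_abs real_sqrt_le_mono)
  then have "\<bar>mixed_det X V / sqrt (pencil_discr X V)\<bar> \<le> 1"
    by (auto simp: divide_le_eq_1)
  then have "- 1 \<le> mixed_det X V / sqrt (pencil_discr X V)"
    "mixed_det X V / sqrt (pencil_discr X V) \<le> 1"
    by (simp_all only: abs_le_iff) auto
  moreover have "split_weight X V = 1 / 2 - (mixed_det X V / sqrt (pencil_discr X V)) / 2"
    by (simp add: split_weight_def)
  ultimately show "0 \<le> split_weight X V" "split_weight X V \<le> 1"
    by simp_all
qed

lemma split_average:
  assumes "splits X V"
  shows "X = split_weight X V *\<^sub>R (X + pencil_root (- 1) X V *\<^sub>R V)
    + (1 - split_weight X V) *\<^sub>R (X + pencil_root 1 X V *\<^sub>R V)"
proof (cases "V = 0")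
  case True
  then show ?thesis by (simp flip: scaleR_add_left)
next
  case False
  then have neg: "det X * det V < 0" using assms by (auto simp: splits_def)
  then have V: "det V \<noteq> 0" by auto
  from pencil_discr_pos[OF neg] have
    "split_weight X V * pencil_root (- 1) X V + (1 - split_weight X V) * pencil_root 1 X V = 0"
    using V by (simp add: split_weight_def pencil_root_def field_simps)
  then have "(split_weight X V * pencil_root (- 1) X V
    + (1 - split_weight X V) * pencil_root 1 X V) *\<^sub>R V = 0"
    by simp
  then show ?thesis
    by (simp add: algebra_simps)
qed

text \<open>A singular symmetric matrix has range of dimension at most one, spanned by any nonzero
  image, and its trace is the only eigenvalue that can differ from 0. Taking the image of a given
  vector \<open>e\<close> makes the choice of \<open>p\<close> explicit and hence measurable in
  applications.\<close>

lemma rank_one_decomposition: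
  fixes A :: "real ^ 2 ^ 2"
  assumes A: "A \<in> sym_mat" "det A = 0" and e: "A *v e \<noteq> 0"
  defines "p \<equiv> (1 / norm (A *v e)) *\<^sub>R (A *v e)"
  shows "A = trace A *\<^sub>R outer p p"
proof -
  have s: "A $ 2 $ 1 = A $ 1 $ 2" and d: "A $ 1 $ 1 * A $ 2 $ 2 = A $ 1 $ 2 * A $ 1 $ 2"
    using A by (auto simp: sym_mat_iff det_2)
  let ?u = "A *v e"
  have u: "?u $ 1 = A $ 1 $ 1 * e $ 1 + A $ 1 $ 2 * e $ 2"
    "?u $ 2 = A $ 1 $ 2 * e $ 1 + A $ 2 $ 2 * e $ 2"
    by (simp_all add: matrix_vector_mult_def sum_2 s)
  have n: "norm ?u ^ 2 = ?u $ 1 * ?u $ 1 + ?u $ 2 * ?u $ 2"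
    by (simp add: power2_norm_eq_inner inner_vec_def sum_2)
  have "norm ?u ^ 2 *\<^sub>R A = trace A *\<^sub>R outer ?u ?u"
    unfolding n vec_eq_iff forall_2 trace_def sum_2
    apply (simp add: s u)
    using d by (intro conjI; algebra)
  moreover have "outer p p = (1 / norm ?u ^ 2) *\<^sub>R outer ?u ?u"
    by (simp add: p_def vec_eq_iff power2_eq_square)
  ultimately have "norm ?u ^ 2 *\<^sub>R A = norm ?u ^ 2 *\<^sub>R (trace A *\<^sub>R outer p p)"
    using e by simp
  then show ?thesis using e by (metis norm_eq_zero power_not_zero scaleR_cancel_left)
qed

lemma norm_matrix_vector_le:
  fixes A :: "real ^ 'n ^ 'm"
  shows "norm (A *v x) \<le> norm A * norm x"
proof -
  have "(\<Sum>i\<in>UNIV. (A $ i \<bullet> x)\<^sup>2) \<le> (\<Sum>i\<in>UNIV. (norm (A $ i) * norm x)\<^sup>2)"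
    by (intro sum_mono) (metis Cauchy_Schwarz_ineq2 abs_le_square_iff abs_mult abs_norm_cancel)
  also have "\<dots> = (norm A * norm x)\<^sup>2"
    by (simp add: power_mult_distrib norm_vec_def L2_set_def sum_nonneg flip: sum_distrib_right)
  finally have "(norm (A *v x))\<^sup>2 \<le> (norm A * norm x)\<^sup>2"
    by (simp add: norm_vec_def L2_set_def sum_nonneg matrix_vector_mul_component)
  then show ?thesis by (rule power2_le_imp_le) simp
qed

text \<open>Since \<open>det A = 0\<close>, the mixed frame coefficient is controlled by the square root of the
  tangential one.\<close>

lemma tangential_coeff_lower_bound:
  fixes A :: "real ^ 2 ^ 2"
  assumes e: "norm e = 1" and A: "A \<in> sym_mat" "det A = 0" "norm A \<le> R"
    and ab: "\<bar>a\<bar> \<le> L" "\<bar>b\<bar> \<le> L" and L: "0 < L" and R: "0 < R" and c: "0 < c"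
    and lb: "c \<le> \<bar>a * (e \<bullet> (A *v e)) + 2 * b * (e \<bullet> (A *v rot e))\<bar>"
  shows "min (c / (2 * L)) (c ^ 2 / (16 * L ^ 2 * R)) \<le> \<bar>e \<bullet> (A *v e)\<bar>"
proof -
  define x y z where "x = e \<bullet> (A *v e)" "y = e \<bullet> (A *v rot e)" "z = rot e \<bullet> (A *v rot e)"
  have "det (frame_embed e (vector [x, z, 2 * y])) = 0"
    using frame_embed_coords[OF e A(1)] A(2) by (simp add: x_y_z_def)
  then have xz: "y ^ 2 = x * z" by (simp add: det_frame_embed[OF e] power2_eq_square)
  have re: "norm (rot e) = 1" using e by (simp add: norm_2_eq_1)
  have "\<bar>z\<bar> \<le> norm (A *v rot e)"
    using Cauchy_Schwarz_ineq2[of "rot e" "A *v rot e"] re by (simp add: x_y_z_def)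
  also have "\<dots> \<le> R" using norm_matrix_vector_le[of A "rot e"] A(3) re by simp
  finally have z: "\<bar>z\<bar> \<le> R" .
  have "\<bar>a * x + 2 * b * y\<bar> \<le> \<bar>a\<bar> * \<bar>x\<bar> + 2 * (\<bar>b\<bar> * \<bar>y\<bar>)"
    by (rule order_trans[OF abs_triangle_ineq]) (simp add: abs_mult)
  also have "\<dots> \<le> L * \<bar>x\<bar> + 2 * (L * \<bar>y\<bar>)"
    using ab by (intro add_mono mult_left_mono mult_right_mono) auto
  finally have c_le: "c \<le> L * \<bar>x\<bar> + 2 * (L * \<bar>y\<bar>)" using lb by (simp add: x_y_z_def)
  \<comment> \<open>One of the two terms in \<open>c_le\<close> is at least \<open>c / 2\<close>. If
    it is the second, then \<open>c / (4 * L)\<close> bounds \<bar>y\<bar> from below, and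
    \<open>y ^ 2 = x * z\<close> with \<bar>z\<bar> at most \<open>R\<close> gives the other
    constant.\<close>
  show ?thesis
  proof (cases "c / 2 \<le> L * \<bar>x\<bar>")
    case True
    then have "c / (2 * L) \<le> \<bar>x\<bar>" using L by (simp add: field_simps)
    then show ?thesis by (simp add: x_y_z_def)
  next
    case False
    then have "c / (4 * L) \<le> \<bar>y\<bar>" using c_le L by (simp add: field_simps)
    then have "(c / (4 * L)) ^ 2 \<le> \<bar>y\<bar> ^ 2" by (rule power_mono) (use c L in simp)
    also have "\<dots> = \<bar>x\<bar> * \<bar>z\<bar>" using xz by (metis abs_mult power2_abs abs_power2)
    also have "\<dots> \<le> \<bar>x\<bar> * R" using z by (intro mult_left_mono) auto
    finally have "c ^ 2 / (16 * L ^ 2 * R) \<le> \<bar>x\<bar>"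
      using L R by (simp add: field_simps power2_eq_square)
    then show ?thesis by (simp add: x_y_z_def)
  qed
qed

text \<open>The minimum over the compact unit sphere of \<open>S\<close>, extended by homogeneity.
  This coercivity bounds the rank-one matrices and keeps the suprema defining the determinant shifts
  positive.\<close>

lemma pos_def_quadratic_lower_bound:
  fixes Q :: "'a::euclidean_space \<Rightarrow> real"
  assumes S: "subspace S" and Q: "quadratic_form_on S Q" and pos: "pos_def_on S Q"
  obtains \<mu> where "\<mu> > 0" "\<And>x. x \<in> S \<Longrightarrow> \<mu> * norm x ^ 2 \<le> Q x"
proof -
  obtain b where b: "bilinear b" and Qb: "\<And>x. x \<in> S \<Longrightarrow> Q x = b x x"
    using Q unfolding quadratic_form_on_def by blast
  have cont: "continuous_on UNIV (\<lambda>x. b x x)"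
    by (rule bilinear_continuous_on_compose[OF continuous_on_id continuous_on_id b])
  have "compact (sphere 0 1 \<inter> S)"
    using S by (intro compact_Int_closed closed_subspace) auto
  show thesis
  proof (cases "sphere 0 1 \<inter> S = {}")
    case True
    have S0: "x = 0" if "x \<in> S" for x
    proof (rule ccontr)
      assume "x \<noteq> 0"
      then have "(1 / norm x) *\<^sub>R x \<in> sphere 0 1 \<inter> S" using that S by (simp add: subspace_scale)
      then show False using True by blast
    qed
    then have "1 * norm x ^ 2 \<le> Q x" if "x \<in> S" for x
      using S0[OF that] Qb[OF that] bilinear_lzero[OF b] by simp
    then show ?thesis by (rule that[OF zero_less_one])
  next
    case False
    obtain u where u: "u \<in> sphere 0 1 \<inter> S" "\<And>y. y \<in> sphere 0 1 \<inter> S \<Longrightarrow> b u u \<le> b y y"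
      using continuous_attains_inf[OF \<open>compact _\<close> False continuous_on_subset[OF cont]] by auto
    show ?thesis
    proof (rule that[of "b u u"])
      show "b u u > 0" using u Qb[of u] pos by (auto simp: pos_def_on_def)
      fix x assume x: "x \<in> S"
      show "b u u * norm x ^ 2 \<le> Q x"
      proof (cases "x = 0")
        case True
        then show ?thesis using Qb[OF x] bilinear_lzero[OF b] by simp
      next
        case False
        then have "b u u \<le> b ((1 / norm x) *\<^sub>R x) ((1 / norm x) *\<^sub>R x)"
          using x S by (intro u) (simp add: subspace_scale)
        also have "\<dots> = Q x / norm x ^ 2"
          by (simp add: bilinear_lmul[OF b] bilinear_rmul[OF b] Qb[OF x] power2_eq_square)
        finally show ?thesis using False by (simp add: field_simps)
      qed
    qed
  qed
qed

text \<open>A real \<open>Sup\<close> is informative only for a nonempty bounded set. Coercivity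
  puts \<open>\<mu> / 2\<close> into the set, and the sign \<sigma> treats both shifts at
  once.\<close>

lemma sup_det_shift_pos:
  fixes Q :: "real ^ 2 ^ 2 \<Rightarrow> real"
  assumes Q: "quadratic_form_on sym_mat Q" and pos: "pos_def_on sym_mat Q" and \<sigma>: "\<sigma> ^ 2 = 1"
  shows "0 < Sup {a. a > 0 \<and> (\<forall>M\<in>sym_mat. 0 \<le> Q M + a * (\<sigma> * det M))}" (is "0 < Sup ?S")
proof -
  obtain \<mu> where \<mu>: "\<mu> > 0" "\<And>X. X \<in> sym_mat \<Longrightarrow> \<mu> * norm X ^ 2 \<le> Q X"
    by (rule pos_def_quadratic_lower_bound[OF subspace_sym_mat Q pos]) (rule that)
  have "\<bar>\<sigma>\<bar> = 1" using \<sigma> by (auto simp: power2_eq_1_iff)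
  then have det_le: "\<bar>\<sigma> * det X\<bar> \<le> 2 * norm X ^ 2" for X :: "real ^ 2 ^ 2"
    using det_le_norm[of X] by (simp add: abs_mult)
  have mem: "\<mu> / 2 \<in> ?S"
  proof (safe)
    fix X :: "real ^ 2 ^ 2" assume X: "X \<in> sym_mat"
    have "\<bar>\<mu> / 2 * (\<sigma> * det X)\<bar> \<le> \<mu> * norm X ^ 2"
      using det_le[of X] \<mu>(1) by (simp add: abs_mult)
    then show "0 \<le> Q X + \<mu> / 2 * (\<sigma> * det X)" using \<mu>(2)[OF X] by linarith
  qed (use \<mu> in simp)
  \<comment> \<open>At this matrix the shifted form equals \<open>Q D - a\<close>, so no admissible
    \<open>a\<close> exceeds \<open>Q D\<close>.\<close>
  define D :: "real ^ 2 ^ 2" where "D = vector [vector [1, 0], vector [0, - \<sigma>]]"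
  have D: "D \<in> sym_mat" "\<sigma> * det D = - 1"
    using \<sigma> by (simp_all add: D_def sym_mat_iff det_2 power2_eq_square)
  have "bdd_above ?S"
    by (rule bdd_aboveI[of _ "Q D"]) (use D in fastforce)
  then have "\<mu> / 2 \<le> Sup ?S" using mem by (rule cSup_upper[rotated])
  then show ?thesis using \<mu>(1) by linarith
qed

lemma alphaQ_pos:
  assumes "quadratic_form_on sym_mat Q" "pos_def_on sym_mat Q"
  shows "alphaQ_plus Q > 0" "alphaQ_minus Q > 0"
  using sup_det_shift_pos[OF assms, of 1] sup_det_shift_pos[OF assms, of "- 1"]
  by (simp_all add: alphaQ_plus_def alphaQ_minus_def)

section \<open>The energy density and its behaviour along the splitting direction\<close>

definition energy_density :: "(real ^ 2 ^ 2 \<Rightarrow> real) \<Rightarrow> real ^ 2 ^ 2 \<Rightarrow> real" where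
  "energy_density Q X = Q X + alphaQ_plus Q * max (det X) 0 + alphaQ_minus Q * max (- det X) 0"

text \<open>The value 0 for \<open>det X = 0\<close> falls under the degenerate case of
  \<open>splits\<close>, so the same root and weight formulas apply at every point.\<close>

definition split_dir ::
    "(real ^ 2 \<Rightarrow> real ^ 2) \<Rightarrow> real \<Rightarrow> real ^ 3 \<Rightarrow> real ^ 3 \<Rightarrow> real ^ 2 ^ 2 \<Rightarrow> real ^ 2 ^ 2" where
  "split_dir chi t vp vm X =
    (if det X > 0 then frame_embed (tangent chi t) vp
     else if det X < 0 then frame_embed (tangent chi t) vm else 0)"

text \<open>Invariance along the line from 0 to \<open>V\<close> gives
  \<open>Q V + a det V = 0\<close>, while \<open>Q V\<close> is positive.\<close>

lemma kernel_direction_det_neg: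
  assumes e: "norm (tangent chi t) = 1" and Q: "quadratic_form_on sym_mat Q" "pos_def_on sym_mat Q"
    and v: "(K_mat chi Q t + a *\<^sub>R det_mat) *v v = 0" "v \<noteq> 0"
  shows "a * det (frame_embed (tangent chi t) v) < 0"
proof -
  let ?V = "frame_embed (tangent chi t) v"
  have "Q ?V + a * det ?V = 0"
    using kernel_direction_invariance[OF e Q(1) v(1) zero_sym_mat, of 1]
      quadratic_form_on_0[OF Q(1) zero_sym_mat] by (simp add: det_2)
  moreover have "Q ?V > 0"
    using Q(2) v(2) frame_embed_sym frame_embed_eq_0_iff[OF e] by (auto simp: pos_def_on_def)
  ultimately show ?thesis by linarith
qed

text \<open>At a singular point of the line \<open>Q\<close> agrees with the shifted form, whose
  constant value is the one at \<open>X\<close>; the sign of \<open>det X\<close> makes this the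
  energy density, where only one of the two extra terms survives.\<close>

lemma split_dir_props:
  assumes e: "norm (tangent chi t) = 1" and Q: "quadratic_form_on sym_mat Q" "pos_def_on sym_mat Q"
    and vp: "vp \<in> V_plus chi Q t" "vp \<noteq> 0" and vm: "vm \<in> V_minus chi Q t" "vm \<noteq> 0"
    and X: "X \<in> sym_mat"
  defines "V \<equiv> split_dir chi t vp vm X"
  shows split_dir_sym: "V \<in> sym_mat"
    and split_dir_splits: "splits X V"
    and split_dir_energy: "det (X + s *\<^sub>R V) = 0 \<Longrightarrow> Q (X + s *\<^sub>R V) = energy_density Q X"
proof -
  have vp': "(K_mat chi Q t + alphaQ_plus Q *\<^sub>R det_mat) *v vp = 0"
    using vp by (simp add: V_plus_def)
  have vm': "(K_mat chi Q t + (- alphaQ_minus Q) *\<^sub>R det_mat) *v vm = 0"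
    using vm by (simp add: V_minus_def)
  have det_p: "det (frame_embed (tangent chi t) vp) < 0"
    using kernel_direction_det_neg[OF e Q vp' vp(2)] alphaQ_pos(1)[OF Q]
      by (simp add: mult_less_0_iff)
  have det_m: "det (frame_embed (tangent chi t) vm) > 0"
    using kernel_direction_det_neg[OF e Q vm' vm(2)] alphaQ_pos(2)[OF Q]
      by (simp add: zero_less_mult_iff)
  show "V \<in> sym_mat"
    by (simp add: V_def split_dir_def frame_embed_sym zero_sym_mat)
  show "splits X V"
    using det_p det_m by (auto simp: V_def split_dir_def splits_def mult_pos_neg mult_neg_pos)
  assume 0: "det (X + s *\<^sub>R V) = 0"
  consider "det X > 0" | "det X < 0" | "det X = 0" by linarith
  then show "Q (X + s *\<^sub>R V) = energy_density Q X"
  proof cases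
    case 1
    then show ?thesis
      using 0 kernel_direction_invariance[OF e Q(1) vp' X, of s]
      by (simp add: V_def split_dir_def energy_density_def)
  next
    case 2
    then show ?thesis
      using 0 kernel_direction_invariance[OF e Q(1) vm' X, of s]
      by (simp add: V_def split_dir_def energy_density_def)
  next
    case 3
    then show ?thesis by (simp add: V_def split_dir_def energy_density_def)
  qed
qed

lemma energy_density_bound:
  assumes Q: "quadratic_form_on sym_mat Q"
  obtains K where "0 \<le> K" "\<And>X. X \<in> sym_mat \<Longrightarrow> \<bar>energy_density Q X\<bar> \<le> K * norm X ^ 2"
proof -
  obtain b where b: "bilinear b" and Qb: "\<And>X. X \<in> sym_mat \<Longrightarrow> Q X = b X X"
    using Q unfolding quadratic_form_on_def by blast
  obtain k where k: "\<And>x y. norm (b x y) \<le> norm x * norm y * k" "0 \<le> k"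
    using bounded_bilinear.nonneg_bounded b[unfolded bilinear_conv_bounded_bilinear] by metis
  define K where "K = k + \<bar>alphaQ_plus Q\<bar> * 2 + \<bar>alphaQ_minus Q\<bar> * 2"
  show thesis
  proof (rule that[of K])
    show "0 \<le> K" using k by (simp add: K_def)
    fix X :: "real ^ 2 ^ 2" assume X: "X \<in> sym_mat"
    have Q_le: "\<bar>Q X\<bar> \<le> k * norm X ^ 2"
      using k(1)[of X X] Qb[OF X] by (simp add: power2_eq_square mult.commute)
    have max_le: "\<bar>a * max d 0\<bar> \<le> \<bar>a\<bar> * 2 * norm X ^ 2" if "\<bar>d\<bar> = \<bar>det X\<bar>" for a d
    proof -
      have "\<bar>max d 0\<bar> \<le> 2 * norm X ^ 2" using det_le_norm[of X] that by linarith
      then have "\<bar>a\<bar> * \<bar>max d 0\<bar> \<le> \<bar>a\<bar> * (2 * norm X ^ 2)" by (intro mult_left_mono) auto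
      then show ?thesis by (simp add: abs_mult mult.assoc)
    qed
    have "\<bar>energy_density Q X\<bar> \<le> \<bar>Q X\<bar> + \<bar>alphaQ_plus Q * max (det X) 0\<bar>
        + \<bar>alphaQ_minus Q * max (- det X) 0\<bar>"
      unfolding energy_density_def
      by (rule order_trans[OF abs_triangle_ineq add_right_mono[OF abs_triangle_ineq]])
    also have "\<dots> \<le> k * norm X ^ 2 + \<bar>alphaQ_plus Q\<bar> * 2 * norm X ^ 2
        + \<bar>alphaQ_minus Q\<bar> * 2 * norm X ^ 2"
      by (intro add_mono Q_le max_le) simp_all
    also have "\<dots> = K * norm X ^ 2" by (simp add: K_def distrib_right)
    finally show "\<bar>energy_density Q X\<bar> \<le> K * norm X ^ 2" .
  qed
qed

text \<open>\<open>Q\<close> is prescribed only on \<open>sym_mat\<close>; there it coincides with a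
  form \<open>b x x\<close> that is continuous on the whole space.\<close>

lemma borel_measurable_energy_density:
  assumes Q: "quadratic_form_on sym_mat Q" and f [measurable]: "f \<in> borel_measurable M"
    and sym: "\<And>x. x \<in> space M \<Longrightarrow> f x \<in> sym_mat"
  shows "(\<lambda>x. energy_density Q (f x)) \<in> borel_measurable M"
proof -
  obtain b where b: "bilinear b" and Qb: "\<And>X. X \<in> sym_mat \<Longrightarrow> Q X = b X X"
    using Q unfolding quadratic_form_on_def by blast
  have "continuous_on UNIV (\<lambda>x. b x x)"
    by (rule bilinear_continuous_on_compose[OF continuous_on_id continuous_on_id b])
  from borel_measurable_continuous_on[OF this f]
  have "(\<lambda>x. Q (f x)) \<in> borel_measurable M"
    by (subst measurable_cong[where g = "\<lambda>x. b (f x) (f x)"]) (auto simp: Qb sym)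
  then show ?thesis unfolding energy_density_def by measurable
qed

text \<open>The functional \<open>a x + b z\<close> vanishes on \<open>V\<close>, so its lower bound
  at \<open>X\<close> passes unchanged to the singular point. The factor 2 before \<open>b\<close>
  appears because \<open>z\<close> is twice the mixed coefficient.\<close>

lemma rank_one_on_line_tangential_ge:
  assumes e: "norm (tangent chi t) = 1" and X: "X \<in> sym_mat"
    and V: "V = 0 \<or> V = frame_embed (tangent chi t) v" and v: "a * v $ 1 + b * v $ 3 = 0"
    and ab: "\<bar>a\<bar> \<le> L" "\<bar>b\<bar> \<le> L" and L: "0 < L" and R: "0 < R" and c: "0 < c"
    and lb: "c \<le> \<bar>a * frame_coeffs chi t X $ 1 $ 1 + 2 * b * frame_coeffs chi t X $ 1 $ 2\<bar>"
    and A: "det (X + s *\<^sub>R V) = 0" "norm (X + s *\<^sub>R V) \<le> R"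
  shows "min (c / (2 * L)) (c ^ 2 / (16 * L ^ 2 * R))
    \<le> \<bar>tangent chi t \<bullet> ((X + s *\<^sub>R V) *v tangent chi t)\<bar>"
proof (rule tangential_coeff_lower_bound[OF e _ A ab L R c])
  let ?e = "tangent chi t"
  have "V \<in> sym_mat" using V frame_embed_sym zero_sym_mat by auto
  then show "X + s *\<^sub>R V \<in> sym_mat"
    using X subspace_sym_mat by (simp add: subspace_add subspace_scale)
  have add: "x \<bullet> ((X + s *\<^sub>R V) *v y) = x \<bullet> (X *v y) + s * (x \<bullet> (V *v y))" for x y
    by (simp add: matrix_vector_mult_add_rdistrib inner_add_right flip: scaleR_matrix_vector_assoc)
  have "a * (?e \<bullet> (V *v ?e)) + 2 * b * (?e \<bullet> (V *v rot ?e)) = 0"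
    using V v by (auto simp: frame_embed_tangential[OF e])
  then have "s * (a * (?e \<bullet> (V *v ?e)) + 2 * b * (?e \<bullet> (V *v rot ?e))) = 0" by simp
  then have "a * (?e \<bullet> ((X + s *\<^sub>R V) *v ?e)) + 2 * b * (?e \<bullet> ((X + s *\<^sub>R V) *v rot ?e))
      = a * frame_coeffs chi t X $ 1 $ 1 + 2 * b * frame_coeffs chi t X $ 1 $ 2"
    unfolding add frame_coeffs_sym[OF e X] by (simp add: algebra_simps)
  then show "c \<le> \<bar>a * (?e \<bullet> ((X + s *\<^sub>R V) *v ?e)) + 2 * b * (?e \<bullet> ((X + s *\<^sub>R V) *v rot ?e))\<bar>"
    using lb by simp
qed

lemma A_field_entries:
  "A_field chi M t $ 1 $ 3 = frame_coeffs chi t (M t) $ 1 $ 1"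
  "A_field chi M t $ 2 $ 3 = frame_coeffs chi t (M t) $ 1 $ 2"
  by (simp_all add: A_field_def Let_def)

lemma continuous_on_unit_interval_bounded:
  assumes "continuous_on (closure unit_ival) (f :: real \<Rightarrow> real)"
  obtains L where "\<And>t. t \<in> unit_ival \<Longrightarrow> \<bar>f t\<bar> \<le> L"
proof -
  have "bounded (f ` closure unit_ival)"
    using assms by (intro compact_imp_bounded compact_continuous_image) auto
  then obtain L where "\<And>y. y \<in> f ` closure unit_ival \<Longrightarrow> norm y \<le> L"
    unfolding bounded_iff by blast
  then have "\<bar>f t\<bar> \<le> L" if "t \<in> unit_ival" for t
    using that closure_subset[of unit_ival] by auto
  then show thesis by (rule that)
qed

section \<open>The approximating sequence\<close>

theorem theorem3p2:
  fixes chi :: "real ^ 2 \<Rightarrow> real ^ 2"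
    and Q :: "real ^ 2 ^ 2 \<Rightarrow> real"
    and vp vm :: "real \<Rightarrow> real ^ 3"
    and \<alpha>p \<beta>p \<alpha>m \<beta>m :: "real \<Rightarrow> real"
    and r c :: real
    and M :: "real \<Rightarrow> real ^ 2 ^ 2"
  assumes chi_inj: "inj chi"
    and chi_C2: "C2_map chi"
    and chi_orient: "\<And>x. det (jacobian chi (at x)) > 0"
    and chi_arc: "\<And>t. norm (column 1 (D_mat chi t)) = 1"
    and chi_0: "chi 0 = 0"
    and chi_e1: "column 1 (D_mat chi 0) = axis 1 1"
    and Q_form: "quadratic_form_on sym_mat Q"
    and Q_pos: "pos_def_on sym_mat Q"
    and vp_C1: "vp C1_differentiable_on unit_ival"
    and vm_C1: "vm C1_differentiable_on unit_ival"
    and vp_V: "\<And>t. t \<in> unit_ival \<Longrightarrow> vp t \<in> V_plus chi Q t \<and> vp t \<noteq> 0"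
    and vm_V: "\<And>t. t \<in> unit_ival \<Longrightarrow> vm t \<in> V_minus chi Q t \<and> vm t \<noteq> 0"
    and cont_p: "continuous_on (closure unit_ival) \<alpha>p" "continuous_on (closure unit_ival) \<beta>p"
    and cont_m: "continuous_on (closure unit_ival) \<alpha>m" "continuous_on (closure unit_ival) \<beta>m"
    and plane_p: "\<And>t. t \<in> unit_ival \<Longrightarrow>
          span {axis 2 1, vp t} = {w. \<alpha>p t * w $ 1 + \<beta>p t * w $ 3 = 0}"
    and plane_m: "\<And>t. t \<in> unit_ival \<Longrightarrow>
          span {axis 2 1, vm t} = {w. \<alpha>m t * w $ 1 + \<beta>m t * w $ 3 = 0}"
    and r_pos: "r > 0"
    and r_p: "\<And>t. t \<in> unit_ival \<Longrightarrow> norm (\<alpha>p t, \<beta>p t) > r"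
    and r_m: "\<And>t. t \<in> unit_ival \<Longrightarrow> norm (\<alpha>m t, \<beta>m t) > r"
    and M_PC: "M \<in> PC_frame chi"
    and c_pos: "c > 0"
    and A_PC: "A_field chi M \<in> PC_skew unit_ival
          (\<lambda>t. U_skew_c c \<inter> U_skew_ab c (\<alpha>p t) (\<beta>p t) \<inter> U_skew_ab c (\<alpha>m t) (\<beta>m t))"
  shows "\<exists>(lam :: nat \<Rightarrow> real \<Rightarrow> real) (p :: nat \<Rightarrow> real \<Rightarrow> real ^ 2)
            (Mn :: nat \<Rightarrow> real \<Rightarrow> real ^ 2 ^ 2).
      (\<forall>n\<ge>1. lam n \<in> Linfty_on unit_ival UNIV \<and>
              p n \<in> Linfty_on unit_ival (sphere 0 1) \<and>
              (\<forall>x\<in>unit_ival - inner_ival n. lam n x = 0)) \<and>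
      Mn = (\<lambda>n x. lam n x *\<^sub>R outer (p n x) (p n x)) \<and>
      weak_star_Linfty unit_ival sym_mat Mn M \<and>
      (\<lambda>n. energy chi Q (Mn n)) \<longlonglongrightarrow> energy chi Q M \<and>
      (\<exists>c'>0. \<forall>n\<ge>1. AE x in lebesgue_on (inner_ival n).
          \<bar>frame_coeffs chi x (Mn n x) $ 1 $ 1\<bar> \<ge> c')"
proof -
  let ?I = unit_ival and ?N = "lebesgue_on unit_ival"
  interpret N: finite_measure ?N
    by (rule finite_measure_lebesgue_on) auto
  have sets_N [measurable]: "{x \<in> space ?N. x \<in> S} \<in> sets ?N" if "S \<in> sets borel" for S
    using that by (auto simp: sets_restrict_space image_iff intro!: bexI[of _ S])
  define e where "e = tangent chi"
  have e: "norm (tangent chi t) = 1" for t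
    using chi_arc C2_map_frame(1)[OF chi_C2] by simp
  have meas_cont: "f \<in> borel_measurable ?N" if "continuous_on ?I f"
    for f :: "real \<Rightarrow> 'a::euclidean_space"
    using that by (intro continuous_imp_measurable_on_sets_lebesgue) auto
  have e_cont: "continuous_on ?I e"
    unfolding e_def using C2_map_frame(3)[OF chi_C2] continuous_on_subset by blast
  then have e_meas [measurable]: "e \<in> borel_measurable ?N" by (rule meas_cont)
  have M_meas [measurable]: "M \<in> borel_measurable ?N" and M_sym: "\<And>x. x \<in> ?I \<Longrightarrow> M x \<in> sym_mat"
    using M_PC by (auto simp: PC_frame_def Linfty_on_def)
  obtain C0 where C0: "AE x in ?N. norm (M x) \<le> C0"
    using M_PC by (auto simp: PC_frame_def Linfty_on_def)
  obtain K where K: "0 \<le> K" "\<And>X. X \<in> sym_mat \<Longrightarrow> \<bar>energy_density Q X\<bar> \<le> K * norm X ^ 2"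
    by (rule energy_density_bound[OF Q_form]) (rule that)
  obtain \<mu> where \<mu>: "\<mu> > 0" "\<And>X. X \<in> sym_mat \<Longrightarrow> \<mu> * norm X ^ 2 \<le> Q X"
    by (rule pos_def_quadratic_lower_bound[OF subspace_sym_mat Q_form Q_pos]) (rule that)
  define W where "W x = energy_density Q (M x)" for x
  have W_meas [measurable]: "W \<in> borel_measurable ?N"
    unfolding W_def by (rule borel_measurable_energy_density[OF Q_form]) (use M_sym in auto)
  define C where "C = K * C0 ^ 2"
  have W_le: "AE x in ?N. \<bar>W x\<bar> \<le> C"
    using C0 AE_space
  proof eventually_elim
    case (elim x)
    then have "\<bar>W x\<bar> \<le> K * norm (M x) ^ 2" unfolding W_def using M_sym by (intro K) auto
    also have "\<dots> \<le> C" unfolding C_def using elim K(1) by (intro mult_left_mono power_mono) auto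
    finally show ?case .
  qed

  \<comment> \<open>\<open>V\<close> jumps where \<open>det (M x)\<close> changes sign, so it is
    treated as measurable only; its branches are continuous on the open interval.\<close>
  define V where "V x = split_dir chi x (vp x) (vm x) (M x)" for x
  have vp_cont: "continuous_on ?I vp" and vm_cont: "continuous_on ?I vm"
    using vp_C1 vm_C1 C1_diff_imp_diff differentiable_imp_continuous_on by blast+
  have emb_meas [measurable]: "(\<lambda>x. frame_embed (tangent chi x) (vp x)) \<in> borel_measurable ?N"
    "(\<lambda>x. frame_embed (tangent chi x) (vm x)) \<in> borel_measurable ?N"
    by (intro meas_cont continuous_on_frame_embed e_cont[unfolded e_def] vp_cont vm_cont)+
  have V_meas [measurable]: "V \<in> borel_measurable ?N"
    unfolding V_def split_dir_def by measurable
  have vp_x: "vp x \<in> V_plus chi Q x" "vp x \<noteq> 0" and vm_x: "vm x \<in> V_minus chi Q x" "vm x \<noteq> 0"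
    if "x \<in> ?I" for x
    using vp_V[OF that] vm_V[OF that] by auto
  note props = split_dir_props[OF e Q_form Q_pos vp_x vm_x M_sym]
  have V_sym: "V x \<in> sym_mat" and V_splits: "splits (M x) (V x)"
    and Q_eq_W: "\<And>s. det (M x + s *\<^sub>R V x) = 0 \<Longrightarrow> Q (M x + s *\<^sub>R V x) = W x" if "x \<in> ?I" for x
    using props[OF that that that that that] unfolding W_def V_def by auto

  define B where "B \<sigma> x = M x + pencil_root \<sigma> (M x) (V x) *\<^sub>R V x" for \<sigma> x
  have discr_meas [measurable]: "(\<lambda>x. mixed_det (M x) (V x)) \<in> borel_measurable ?N"
    "(\<lambda>x. pencil_discr (M x) (V x)) \<in> borel_measurable ?N"
    unfolding pencil_discr_def mixed_det_def by measurable
  have B_meas [measurable]: "B \<sigma> \<in> borel_measurable ?N" for \<sigma>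
    unfolding B_def pencil_root_def by measurable
  have B_sym: "B \<sigma> x \<in> sym_mat" if "x \<in> ?I" for \<sigma> x
    unfolding B_def using that M_sym V_sym subspace_sym_mat
      by (simp add: subspace_add subspace_scale)
  have B_det: "det (B \<sigma> x) = 0" if "x \<in> ?I" "\<sigma> ^ 2 = 1" for \<sigma> x
    unfolding B_def using that V_splits by (intro det_pencil_root)
  have B_W: "energy_density Q (B \<sigma> x) = W x" if "x \<in> ?I" "\<sigma> ^ 2 = 1" for \<sigma> x
    using B_det[OF that] Q_eq_W[OF that(1)] by (simp add: energy_density_def B_def)
  \<comment> \<open>The square root comes from coercivity:
    \<open>\<mu> * norm (B \<sigma> x) ^ 2\<close> is at most \<open>Q (B \<sigma> x) = W x\<close>,
    hence at most \<open>C\<close>, however large the root or \<open>V x\<close> may be. The maximum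
    lets \<open>R\<close> bound \<open>M\<close> too, and the summand 1 makes it positive.\<close>
  define R where "R = max (sqrt (C / \<mu>)) \<bar>C0\<bar> + 1"
  have R: "R > 0" "C0 \<le> R" unfolding R_def by auto
  have B_le: "AE x in ?N. norm (B \<sigma> x) \<le> R" if \<sigma>: "\<sigma> ^ 2 = 1" for \<sigma>
    using W_le AE_space
  proof eventually_elim
    case (elim x)
    then have x: "x \<in> ?I" by simp
    have "\<mu> * norm (B \<sigma> x) ^ 2 \<le> Q (B \<sigma> x)" by (rule \<mu>(2)[OF B_sym[OF x]])
    also have "\<dots> = W x" using B_W[OF x \<sigma>] B_det[OF x \<sigma>] by (simp add: energy_density_def)
    also have "\<dots> \<le> C" using elim by simp
    finally have "norm (B \<sigma> x) ^ 2 \<le> C / \<mu>" using \<mu>(1) by (simp add: field_simps)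
    then have "norm (B \<sigma> x) \<le> sqrt (C / \<mu>)" by (rule real_le_rsqrt)
    then show ?case unfolding R_def by linarith
  qed

  obtain L1 L2 L3 L4 where L14: "\<And>t. t \<in> ?I \<Longrightarrow> \<bar>\<alpha>p t\<bar> \<le> L1" "\<And>t. t \<in> ?I \<Longrightarrow> \<bar>\<beta>p t\<bar> \<le> L2"
    "\<And>t. t \<in> ?I \<Longrightarrow> \<bar>\<alpha>m t\<bar> \<le> L3" "\<And>t. t \<in> ?I \<Longrightarrow> \<bar>\<beta>m t\<bar> \<le> L4"
    using continuous_on_unit_interval_bounded[OF cont_p(1)] continuous_on_unit_interval_bounded[OF
      cont_p(2)]
      continuous_on_unit_interval_bounded[OF cont_m(1)] continuous_on_unit_interval_bounded[OF
        cont_m(2)]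
    by metis
  define L where "L = Max {1, L1, L2, L3, L4}"
  have L_ge: "1 \<le> L" "L1 \<le> L" "L2 \<le> L" "L3 \<le> L" "L4 \<le> L" unfolding L_def by simp_all
  then have L: "0 < L" by linarith
  have ab_le: "\<bar>\<alpha>p t\<bar> \<le> L" "\<bar>\<beta>p t\<bar> \<le> L" "\<bar>\<alpha>m t\<bar> \<le> L" "\<bar>\<beta>m t\<bar> \<le> L" if "t \<in> ?I" for t
    using L14[OF that] L_ge by linarith+
  \<comment> \<open>The bound \<open>R'\<close> is left free for two uses: with the uniform
    \<open>R\<close> almost everywhere it gives the final constant, with a pointwise bound it gives
    nonvanishing at every point.\<close>
  have lower: "min (c / (2 * L)) (c ^ 2 / (16 * L ^ 2 * R')) \<le> \<bar>e x \<bullet> (B \<sigma> x *v e x)\<bar>"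
    if x: "x \<in> ?I" and \<sigma>: "\<sigma> ^ 2 = 1" and R': "0 < R'" "norm (B \<sigma> x) \<le> R'" for x \<sigma> R'
  proof -
    have AP: "c \<le> \<bar>\<alpha>p x * frame_coeffs chi x (M x) $ 1 $ 1
      + 2 * \<beta>p x * frame_coeffs chi x (M x) $ 1 $ 2\<bar>"
      "c \<le> \<bar>\<alpha>m x * frame_coeffs chi x (M x) $ 1 $ 1 + 2 * \<beta>m x * frame_coeffs chi x (M x) $ 1 $ 2\<bar>"
      using A_PC x by (auto simp: PC_skew_def U_skew_ab_def A_field_entries)
    have vp0: "\<alpha>p x * vp x $ 1 + \<beta>p x * vp x $ 3 = 0"
      using plane_p[OF x] span_base[of "vp x" "{axis 2 1, vp x}"] by auto
    have vm0: "\<alpha>m x * vm x $ 1 + \<beta>m x * vm x $ 3 = 0"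
      using plane_m[OF x] span_base[of "vm x" "{axis 2 1, vm x}"] by auto
    \<comment> \<open>For \<open>V x = 0\<close> either plane serves; otherwise the sign of
      \<open>det (M x)\<close> selects it.\<close>
    have "(V x = 0 \<or> V x = frame_embed (tangent chi x) (vp x)) \<or> (V x = 0 \<or> V x
      = frame_embed (tangent chi x) (vm x))"
      by (auto simp: V_def split_dir_def)
    then show ?thesis
      unfolding e_def B_def
      using rank_one_on_line_tangential_ge[OF e M_sym[OF x] _ vp0 ab_le(1,2)[OF x] L R'(1) c_pos
        AP(1)]
        rank_one_on_line_tangential_ge[OF e M_sym[OF x] _ vm0 ab_le(3,4)[OF x] L R'(1) c_pos AP(2)]
        B_det[OF x \<sigma>, unfolded B_def] R'(2)[unfolded B_def] by blast
  qed
  \<comment> \<open>Needed at every point, not just almost everywhere, since the image of the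
    tangent defines \<open>p\<close> and \<open>Mn\<close> is to equal \<open>P\<close> on all of
    the interval.\<close>
  have B_e: "B \<sigma> x *v e x \<noteq> 0" if "x \<in> ?I" "\<sigma> ^ 2 = 1" for x \<sigma>
  proof
    assume 0: "B \<sigma> x *v e x = 0"
    have pos: "0 < norm (B \<sigma> x) + 1" using norm_ge_zero[of "B \<sigma> x"] by linarith
    then have "0 < min (c / (2 * L)) (c ^ 2 / (16 * L ^ 2 * (norm (B \<sigma> x) + 1)))"
      using c_pos L by simp
    also have "\<dots> \<le> \<bar>e x \<bullet> (B \<sigma> x *v e x)\<bar>" by (rule lower[OF that pos]) simp
    finally show False using 0 by simp
  qed

  \<comment> \<open>Clamping changes nothing on the unit interval; it provides the bounds at all
    real arguments that the construction of \<open>E\<close> asks for.\<close>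
  define \<theta> where "\<theta> x = max 0 (min 1 (split_weight (M x) (V x)))" for x
  have \<theta>_meas: "\<theta> \<in> borel_measurable ?N"
    unfolding \<theta>_def split_weight_def by measurable
  have \<theta>_ge: "0 \<le> \<theta> x" and \<theta>_le: "\<theta> x \<le> 1" for x
    by (simp_all add: \<theta>_def)
  have M_eq: "M x = \<theta> x *\<^sub>R B (- 1) x + (1 - \<theta> x) *\<^sub>R B 1 x" if "x \<in> ?I" for x
  proof -
    have "\<theta> x = split_weight (M x) (V x)"
      using split_weight_bounds[OF V_splits[OF that]] by (simp add: \<theta>_def)
    then show ?thesis using split_average[OF V_splits[OF that]] by (simp add: B_def)
  qed
  obtain E where E [measurable]: "\<And>n. E n \<in> sets borel"
    and E_lim: "\<And>g. integrable ?N g \<Longrightarrow> (\<lambda>n. \<integral>x. (indicator (E n) x - \<theta> x) * g x \<partial>?N) \<longlonglongrightarrow> 0"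
    by (rule indicators_weak_star_dense[OF \<theta>_meas \<theta>_ge \<theta>_le]) (rule that)
  define P where "P n x = (if x \<in> inner_ival n then if x \<in> E n then B (- 1) x else B 1 x else 0)"
    for n x
  have P_cases: "P n x = 0 \<or> (x \<in> inner_ival n \<and> (P n x = B (- 1) x \<or> P n x = B 1 x))" for n x
    by (simp add: P_def)
  have P_inner: "P n x = B (- 1) x \<or> P n x = B 1 x" if "x \<in> inner_ival n" for n x
    using that by (simp add: P_def)
  have P_meas [measurable]: "P n \<in> borel_measurable ?N" for n
    unfolding P_def by measurable
  have P_sym: "P n x \<in> sym_mat" if "x \<in> ?I" for n x
    using P_cases[of n x] B_sym[OF that] zero_sym_mat by auto
  have P_det: "det (P n x) = 0" if "x \<in> ?I" for n x
    using P_cases[of n x] B_det[OF that] by (auto simp: det_2)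
  have P_le: "AE x in ?N. norm (P n x) \<le> R" for n
    using B_le[of "- 1", simplified] B_le[of 1, simplified]
    by eventually_elim (use R in \<open>auto simp: P_def\<close>)
  have P_W: "energy_density Q (P n x) = (if x \<in> inner_ival n then W x else 0)" if "x \<in> ?I" for n x
    using P_inner[of x n] B_W[OF that] quadratic_form_on_0[OF Q_form zero_sym_mat]
    by (auto simp: P_def energy_density_def det_2)
  have P_Linf: "P n \<in> Linfty_on ?I sym_mat" for n
    using P_le[of n] P_sym by (auto simp: Linfty_on_def)

  define lam where "lam n x = trace (P n x)" for n x
  \<comment> \<open>The default unit vector keeps \<open>p\<close> on the circle. Inside the unit
    interval it occurs only where \<open>P n x = 0\<close>, by \<open>B_e\<close>, and there
    \<open>lam n x = 0\<close>.\<close>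
  define p where "p n x = (if P n x *v e x = 0 then axis 1 1
    else (1 / norm (P n x *v e x)) *\<^sub>R (P n x *v e x))" for n x
  define Mn where "Mn n x = lam n x *\<^sub>R outer (p n x) (p n x)" for n x
  have Mn_P: "Mn n x = P n x" if "x \<in> ?I" for n x
  proof (cases "P n x *v e x = 0")
    case True
    then have "P n x = 0" using P_cases[of n x] B_e[OF that] by auto
    then show ?thesis by (simp add: Mn_def lam_def trace_def)
  next
    case False
    then show ?thesis
      using rank_one_decomposition[OF P_sym[OF that] P_det[OF that] False]
      by (simp add: Mn_def lam_def p_def)
  qed
  have lam_Linf: "lam n \<in> Linfty_on ?I UNIV" for n
  proof -
    have meas: "lam n \<in> borel_measurable ?N" unfolding lam_def trace_def sum_2 by measurable
    have trace_le: "\<bar>trace X\<bar> \<le> 2 * norm X" for X :: "real ^ 2 ^ 2"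
      using matrix_entry_le_norm[of X 1 1] matrix_entry_le_norm[of X 2 2]
      unfolding trace_def sum_2 by linarith
    have "AE x in ?N. norm (lam n x) \<le> 2 * R"
      using P_le[of n]
    proof eventually_elim
      case (elim x)
      then show ?case using trace_le[of "P n x"] by (simp add: lam_def)
    qed
    with meas show ?thesis by (auto simp: Linfty_on_def)
  qed
  have p_norm: "norm (p n x) = 1" for n x by (simp add: p_def)
  have p_Linf: "p n \<in> Linfty_on ?I (sphere 0 1)" for n
  proof -
    have "p n \<in> borel_measurable ?N" unfolding p_def by measurable
    then show ?thesis using p_norm by (auto simp: Linfty_on_def intro!: exI[of _ 1])
  qed
  have Mn_Linf: "Mn n \<in> Linfty_on ?I sym_mat" for n
    using P_Linf[of n] Linfty_on_cong[of ?I "Mn n" "P n"] Mn_P by blast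
  have weak: "weak_star_Linfty ?I sym_mat Mn M"
    unfolding weak_star_Linfty_def
  proof (intro conjI allI impI)
    show "\<forall>\<^sub>F n in sequentially. Mn n \<in> Linfty_on ?I sym_mat" using Mn_Linf by simp
    show "M \<in> Linfty_on ?I sym_mat" using M_PC by (simp add: PC_frame_def)
    fix \<phi> :: "real \<Rightarrow> real ^ 2 ^ 2"
    assume \<phi>: "integrable ?N \<phi> \<and> (\<forall>x\<in>?I. \<phi> x \<in> sym_mat)"
    have M_le: "AE x in ?N. norm (M x) \<le> R" using C0 R(2) by (auto elim!: eventually_mono)
    have "(\<lambda>n. \<integral>x. P n x \<bullet> \<phi> x \<partial>?N) \<longlonglongrightarrow> (\<integral>x. M x \<bullet> \<phi> x \<partial>?N)"
      unfolding P_def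
      by (rule oscillating_mixture_weak_star[OF B_meas B_meas B_le B_le M_meas M_le M_eq E E_lim])
        (use \<phi> in auto)
    moreover have "(\<integral>x. Mn n x \<bullet> \<phi> x \<partial>?N) = (\<integral>x. P n x \<bullet> \<phi> x \<partial>?N)" for n
      by (rule Bochner_Integration.integral_cong) (simp_all add: Mn_P)
    ultimately show "(\<lambda>n. \<integral>x. Mn n x \<bullet> \<phi> x \<partial>?N) \<longlonglongrightarrow> (\<integral>x. M x \<bullet> \<phi> x \<partial>?N)" by simp
  qed

  have D_cont: "continuous_on S (\<lambda>x. det (D_mat chi x))" for S
    unfolding det_2 by (intro continuous_intros continuous_on_subset[OF C2_map_frame(2)[OF chi_C2]])
      auto
  then have D_meas [measurable]: "(\<lambda>x. det (D_mat chi x)) \<in> borel_measurable ?N" by (rule meas_cont)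
  obtain D where D: "\<And>x. x \<in> ?I \<Longrightarrow> \<bar>det (D_mat chi x)\<bar> \<le> D"
    using continuous_on_unit_interval_bounded[OF D_cont] by metis
  \<comment> \<open>By \<open>P_W\<close> the density is \<open>W\<close> on the inner interval and
    0 outside it, so the integrand is eventually constant at each point and dominated by
    \<open>C * D\<close>.\<close>
  have "(\<lambda>n. \<integral>x. energy_density Q (Mn n x) * det (D_mat chi x) \<partial>?N)
    \<longlonglongrightarrow> (\<integral>x. W x * det (D_mat chi x) \<partial>?N)"
  proof (rule integral_dominated_convergence[where w = "\<lambda>x. C * D"])
    show "(\<lambda>x. W x * det (D_mat chi x)) \<in> borel_measurable ?N" by measurable
    have "(\<lambda>x. (if x \<in> inner_ival n then W x else 0) * det (D_mat chi x)) \<in> borel_measurable ?N"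
      for n
      by measurable
    then show "(\<lambda>x. energy_density Q (Mn n x) * det (D_mat chi x)) \<in> borel_measurable ?N" for n
      by (subst measurable_cong[where g =
        "\<lambda>x. (if x \<in> inner_ival n then W x else 0) * det (D_mat chi x)"])
        (simp_all add: Mn_P P_W)
    show "integrable ?N (\<lambda>x. C * D)" by simp
    show "AE x in ?N. norm (energy_density Q (Mn n x) * det (D_mat chi x)) \<le> C * D" for n
      using W_le AE_space
    proof eventually_elim
      case (elim x)
      then have x: "x \<in> ?I" by simp
      have "\<bar>energy_density Q (Mn n x)\<bar> \<le> C"
        using elim(1) by (auto simp: Mn_P[OF x] P_W[OF x])
      then have "\<bar>energy_density Q (Mn n x)\<bar> * \<bar>det (D_mat chi x)\<bar> \<le> C * D"
        using D[OF x] by (intro mult_mono) auto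
      then show ?case by (simp add: abs_mult)
    qed
    show "AE x in ?N. (\<lambda>n. energy_density Q (Mn n x) * det (D_mat chi x)) \<longlonglongrightarrow> W x * det (D_mat chi x)"
    proof (rule AE_I2)
      fix x assume "x \<in> space ?N"
      then have x: "x \<in> ?I" by simp
      have "\<forall>\<^sub>F n in sequentially. energy_density Q (Mn n x) * det (D_mat chi x)
        = W x * det (D_mat chi x)"
        using eventually_in_inner_ival[OF x] by eventually_elim (simp add: Mn_P[OF x] P_W[OF x])
      then show "(\<lambda>n. energy_density Q (Mn n x) * det (D_mat chi x)) \<longlonglongrightarrow> W x * det (D_mat chi x)"
        by (rule tendsto_eventually)
    qed
  qed
  then have energy_lim: "(\<lambda>n. energy chi Q (Mn n)) \<longlonglongrightarrow> energy chi Q M"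
    unfolding energy_def W_def energy_density_def .

  \<comment> \<open>Independence of n comes from \<open>R\<close> and \<open>L\<close>, which bound
    both families \<open>B (- 1)\<close> and \<open>B 1\<close> and the plane coefficients before
    any oscillation is chosen.\<close>
  define c' where "c' = min (c / (2 * L)) (c ^ 2 / (16 * L ^ 2 * R))"
  have c': "c' > 0" unfolding c'_def using c_pos L R by simp
  have coeff: "AE x in lebesgue_on (inner_ival n). \<bar>frame_coeffs chi x (Mn n x) $ 1 $ 1\<bar> \<ge> c'" for n
  proof -
    have "AE x in ?N. norm (B (- 1) x) \<le> R \<and> norm (B 1 x) \<le> R"
      using B_le[of "- 1", simplified] B_le[of 1, simplified] by eventually_elim simp
    then have "AE x in lebesgue_on (inner_ival n). norm (B (- 1) x) \<le> R \<and> norm (B 1 x) \<le> R"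
      by (rule AE_lebesgue_on_subset[OF _ inner_ival_subset]) auto
    then show ?thesis
      using AE_space
    proof eventually_elim
      case (elim x)
      then have xn: "x \<in> inner_ival n" by simp
      then have x: "x \<in> ?I" using inner_ival_subset by blast
      have "c' \<le> \<bar>e x \<bullet> (P n x *v e x)\<bar>"
        unfolding c'_def using P_inner[OF xn] lower[OF x _ R(1), of
          "- 1"] lower[OF x _ R(1), of 1] elim(1) by auto
      then show ?case
        by (simp add: Mn_P[OF x] frame_coeffs_sym[OF e P_sym[OF x]] e_def)
    qed
  qed
  have lam_0: "lam n x = 0" if "x \<in> ?I - inner_ival n" for n x
    using that by (simp add: lam_def P_def trace_def)
  have "Mn = (\<lambda>n x. lam n x *\<^sub>R outer (p n x) (p n x))"
    by (simp add: Mn_def fun_eq_iff)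
  with lam_Linf p_Linf lam_0 weak energy_lim c' coeff show ?thesis
    by (intro exI[of _ lam] exI[of _ p] exI[of _ Mn]) auto
qed

end
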